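(* Let $(\boldsymbol u_h,\widehat{\boldsymbol u}_h,p_h)\in\boldsymbol V_h^1\times\widehat{\boldsymbol V}_h^0\times Q_h^0$ be the solution of the reduced-order HDG method with $k=0$, and let $(\boldsymbol u_h^*,p_h^* )\in\widetilde{\boldsymbol V}_h^1\times Q_h^0$ be the solution of the nonconforming Crouzeix-Raviart finite element method. Then $$\boldsymbol\Pi_h^*\widehat{\boldsymbol u}_h=\boldsymbol u_h^*,\qquad p_h=p_h^* .$$
   Context: Let $d\in\{2,3\}$, $\Omega\subset\mathbb R^d$ a convex polygonal or polyhedral domain, $\boldsymbol f\in\boldsymbol L^2(\Omega)$, and $\mathcal T_h$ a (simplicial) triangulation of $\Omega$ from a shape-regular family. Bold letters denote $\mathbb R^d$-valued functions and function spaces. $\mathcal E_h$ is the set of all edges (faces if $d=3$) of $\mathcal T_h$, $\Gamma_h=\bigcup_{K\in\mathcal T_h}\partial K$, and $h_e$ is the length (size) of $e\in\mathcal E_h$. $P_k(\mathcal T_h)$ and $P_k(\mathcal E_h)$ are the spaces of element-wise and edge-wise polynomials of degree $k$; $L^2_0(\Omega)=\{q\in L^2(\Omega):\int_\Omega q\,dx=0\}$. Set $\boldsymbol V_h^{1}=\boldsymbol P_{1}(\mathcal T_h)$, $\widehat{\boldsymbol V}_h^0=\boldsymbol P_0(\mathcal E_h)\cap\{\widehat{\boldsymbol v}\in\boldsymbol L^2(\Gamma_h):\widehat{\boldsymbol v}=\boldsymbol 0\text{ on }\partial\Omega\}$, $Q_h^0=P_0(\mathcal T_h)\cap L^2_0(\Omega)$.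 Write $(u,v)_{\mathcal T_h}=\sum_{K}\int_K uv\,dx$, $\langle u,v\rangle_{\partial\mathcal T_h}=\sum_{K}\int_{\partial K}uv\,ds$ (with the obvious contraction for vector/matrix-valued arguments). $\mathsf P_0$ is the $L^2$-projection from $\prod_K\boldsymbol L^2(\partial K)$ onto edge-wise constants on each $\partial K$. $\boldsymbol n$ is the unit outward normal on $\partial K$ and $\partial_{\boldsymbol n}$ the normal derivative on $\partial K$. Reduced-order HDG method with $k=0$ (the stabilization parameter $\tau\ge1$ being sufficiently large): find $(\boldsymbol u_h,\widehat{\boldsymbol u}_h,p_h)\in\boldsymbol V_h^{1}\times\widehat{\boldsymbol V}_h^0\times Q_h^0$ such that $$a_h(\boldsymbol u_h,\widehat{\boldsymbol u}_h;\boldsymbol v_h,\widehat{\boldsymbol v}_h)+b_h(\boldsymbol v_h,\widehat{\boldsymbol v}_h;p_h)=(\boldsymbol f,\boldsymbol v_h)_\Omega\ \ \forall(\boldsymbol v_h,\widehat{\boldsymbol v}_h)\in\boldsymbol V_h^{1}\times\widehat{\boldsymbol V}_h^0,\qquad b_h(\boldsymbol u_h,\widehat{\boldsymbol u}_h;q_h)=0\ \ \forall q_h\in Q_h^0,$$ where $$a_h(\boldsymbol u,\widehat{\boldsymbol u};\boldsymbol v,\widehat{\boldsymbol v})=(\nabla\boldsymbol u,\nabla\boldsymbol v)_{\mathcal T_h}+\langle\partial_{\boldsymbol n}\boldsymbol u,\widehat{\boldsymbol v}-\boldsymbol v\rangle_{\partial\mathcal T_h}+\langle\partial_{\boldsymbol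 n}\boldsymbol v,\widehat{\boldsymbol u}-\boldsymbol u\rangle_{\partial\mathcal T_h}+\langle\tau h_e^{-1}\mathsf P_0(\widehat{\boldsymbol u}-\boldsymbol u),\mathsf P_0(\widehat{\boldsymbol v}-\boldsymbol v)\rangle_{\partial\mathcal T_h},$$ $$b_h(\boldsymbol v,\widehat{\boldsymbol v};p)=-(\mathrm{div}\,\boldsymbol v,p)_{\mathcal T_h}-\langle\widehat{\boldsymbol v}-\boldsymbol v,p\boldsymbol n\rangle_{\partial\mathcal T_h}.$$ Crouzeix-Raviart method: $\widetilde{\boldsymbol V}_h^1=\{\boldsymbol v_h\in\boldsymbol V_h^1:[\![\mathsf P_0\boldsymbol v_h]\!]=0\}$, where $[\![\cdot]\!]$ is the usual jump across edges (on a boundary edge it is the trace itself, so edge means vanish on $\partial\Omega$). Find $(\boldsymbol u_h^*,p_h^* )\in\widetilde{\boldsymbol V}_h^1\times Q_h^0$ such that $$(\nabla\boldsymbol u_h^*,\nabla\widetilde{\boldsymbol v}_h)_{\mathcal T_h}-(\mathrm{div}\,\widetilde{\boldsymbol v}_h,p_h^* )_{\mathcal T_h}=(\boldsymbol f,\widetilde{\boldsymbol v}_h)_\Omega\ \ \forall\widetilde{\boldsymbol v}_h\in\widetilde{\boldsymbol V}_h^1,\qquad(\mathrm{div}\,\boldsymbol u_h^*,q_h)_{\mathcal T_h}=0\ \ \forall q_h\in Q_h^0 .$$ Crouzeix-Raviart interpolation: for scalar $\widehat v\in L^2(\Gamma_h)$, $\Pi_h^*\widehat v$ is the Crouzeix-Raviart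 function (element-wise linear) determined by $\int_e\Pi_h^*\widehat v\,ds=\int_e\widehat v\,ds$ for all $e\in\mathcal E_h$; for $\widehat{\boldsymbol v}=(\widehat v_1,\dots,\widehat v_d)^T\in\boldsymbol L^2(\Gamma_h)$, $\boldsymbol\Pi_h^*\widehat{\boldsymbol v}=(\Pi_h^*\widehat v_1,\dots,\Pi_h^*\widehat v_d)^T$. *)

theory Defs
  imports "HOL-Analysis.Analysis"
begin

section \<open>Domain and mesh\<close>

definition convex_polyhedral_domain :: "'a::euclidean_space set \<Rightarrow> bool" where
  "convex_polyhedral_domain \<Omega> \<longleftrightarrow>
     open \<Omega> \<and> convex \<Omega> \<and> \<Omega> \<noteq> {} \<and> bounded \<Omega> \<and> polytope (closure \<Omega>)"

definition square_integrable_on ::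
    "('a::euclidean_space \<Rightarrow> 'b::euclidean_space) \<Rightarrow> 'a set \<Rightarrow> bool" (infix "square'_integrable'_on" 50) where
  "f square_integrable_on \<Omega> \<longleftrightarrow>
     f \<in> borel_measurable (lebesgue_on \<Omega>) \<and> integrable (lebesgue_on \<Omega>) (\<lambda>x. (norm (f x))\<^sup>2)"

text \<open>The library predicate \<^const>\<open>triangulation\<close> gives finiteness and conformity (any two cells meet
  in a common face), but allows cells of every dimension.\<close>

definition simplicial_mesh :: "'a::euclidean_space set \<Rightarrow> 'a set set \<Rightarrow> bool" where
  "simplicial_mesh \<Omega> T \<longleftrightarrow>
     triangulation T \<and> (\<forall>K\<in>T. int DIM('a) simplex K) \<and> \<Union>T = closure \<Omega>"

definition inradius :: "'a::euclidean_space set \<Rightarrow> real" where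
  "inradius K = Sup {r. 0 \<le> r \<and> (\<exists>x. cball x r \<subseteq> K)}"

definition shape_regular_family :: "'a::euclidean_space set \<Rightarrow> 'a set set set \<Rightarrow> bool" where
  "shape_regular_family \<Omega> \<F> \<longleftrightarrow>
     (\<forall>T\<in>\<F>. simplicial_mesh \<Omega> T) \<and>
     (\<exists>\<sigma>>0. \<forall>T\<in>\<F>. \<forall>K\<in>T. diameter K \<le> \<sigma> * inradius K)"

definition facets :: "'a::euclidean_space set \<Rightarrow> 'a set set" where
  "facets K = {e. e facet_of K}"

definition mesh_facets :: "'a::euclidean_space set set \<Rightarrow> 'a set set" where
  "mesh_facets T = (\<Union>K\<in>T. facets K)"

text \<open>Unit normal to \<open>K\<close> on its facet \<open>e\<close>, pointing out of \<open>K\<close>; uniquely determined if \<open>K\<close> is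
  full-dimensional.\<close>

definition outer_normal :: "'a::euclidean_space set \<Rightarrow> 'a set \<Rightarrow> 'a" where
  "outer_normal K e =
     (THE n. norm n = 1 \<and> (\<exists>c. e \<subseteq> {x. n \<bullet> x = c} \<and> K \<subseteq> {x. n \<bullet> x \<le> c}))"

text \<open>The \<open>(d - 1)\<close>-dimensional surface measure on a flat facet \<open>e\<close>: the Lebesgue measure of the
  prism of thickness \<open>1\<close> over \<open>e\<close>, orthogonally projected to the hyperplane spanned by \<open>e\<close>.\<close>

definition surface_measure :: "'a::euclidean_space set \<Rightarrow> 'a measure" where
  "surface_measure e =
     (let proj = closest_point (affine hull e)
      in distr (lebesgue_on {x. proj x \<in> e \<and> dist x (proj x) \<le> 1/2}) borel proj)"

section \<open>Piecewise polynomial functions\<close>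

text \<open>A function on the mesh is a family indexed by the cells (so it may be discontinuous
  across facets), and a function on the skeleton is a family indexed by the facets. A polynomial on
  a cell or facet is represented by a polynomial on the whole space. On a cell this extension
  is unique, and so are constants on a facet; with \<^const>\<open>PiE\<close> fixing the junk value outside
  the index set, equality of families is therefore equality of piecewise polynomial functions.\<close>

definition P0 :: "('a::euclidean_space \<Rightarrow> 'b::euclidean_space) set" where
  "P0 = {v. \<exists>c. v = (\<lambda>x. c)}"

definition P1 :: "('a::euclidean_space \<Rightarrow> 'b::euclidean_space) set" where
  "P1 = {v. \<exists>A c. linear A \<and> v = (\<lambda>x. A x + c)}"

type_synonym ('a, 'b) pw = "'a set \<Rightarrow> 'a \<Rightarrow> 'b"

definition vol_inner ::
    "'a::euclidean_space set set \<Rightarrow> ('a, 'b::euclidean_space) pw \<Rightarrow> ('a, 'b) pw \<Rightarrow> real" where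
  "vol_inner T u v = (\<Sum>K\<in>T. LINT x|lebesgue_on K. u K x \<bullet> v K x)"

text \<open>Functions on the cell boundaries are indexed by a cell and one of its facets, since they may take
  different values on the two sides of a facet.\<close>

definition bdry_inner ::
    "'a::euclidean_space set set \<Rightarrow> ('a set \<Rightarrow> ('a, 'b::euclidean_space) pw) \<Rightarrow>
     ('a set \<Rightarrow> ('a, 'b) pw) \<Rightarrow> real" where
  "bdry_inner T g h =
     (\<Sum>K\<in>T. \<Sum>e\<in>facets K. LINT x|surface_measure e. g K e x \<bullet> h K e x)"

text \<open>\<open>L\<^sup>2\<close>-projection onto the constants on a single facet, characterized by orthogonality of the
  error to all constants. Applied facet by facet it is the projection onto the facetwise
  constants.\<close>

definition facet_proj :: "'a::euclidean_space set \<Rightarrow> ('a \<Rightarrow> 'b::euclidean_space) \<Rightarrow> 'a \<Rightarrow> 'b" where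
  "facet_proj e g =
     (THE w. w \<in> P0 \<and> (\<forall>z\<in>P0. (LINT x|surface_measure e. (g x - w x) \<bullet> z x) = 0))"

definition proj0 ::
    "('a::euclidean_space set \<Rightarrow> ('a, 'b::euclidean_space) pw) \<Rightarrow> 'a set \<Rightarrow> ('a, 'b) pw" where
  "proj0 g K e = facet_proj e (g K e)"

text \<open>Vanishing of the jump of a facetwise constant function on the cell boundaries. On an interior
  facet the jump is the difference of the two traces (its sign is irrelevant here), on
  a boundary facet it is the trace itself.\<close>

definition jump_free ::
    "'a::euclidean_space set \<Rightarrow> 'a set set \<Rightarrow> ('a set \<Rightarrow> ('a, 'b::euclidean_space) pw) \<Rightarrow> bool" where
  "jump_free \<Omega> T g \<longleftrightarrow>
     (\<forall>K\<in>T. \<forall>K'\<in>T. \<forall>e\<in>facets K \<inter> facets K'. K \<noteq> K' \<longrightarrow> (\<forall>x\<in>e. g K e x - g K' e x = 0)) \<and>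
     (\<forall>K\<in>T. \<forall>e\<in>facets K. e \<subseteq> frontier \<Omega> \<longrightarrow> (\<forall>x\<in>e. g K e x = 0))"

definition V_space :: "(real^'d) set set \<Rightarrow> (real^'d, real^'d) pw set" where
  "V_space T = (\<Pi>\<^sub>E K\<in>T. P1)"

definition Vhat_space :: "(real^'d) set \<Rightarrow> (real^'d) set set \<Rightarrow> (real^'d, real^'d) pw set" where
  "Vhat_space \<Omega> T =
     {v \<in> (\<Pi>\<^sub>E e\<in>mesh_facets T. P0). \<forall>e\<in>mesh_facets T. e \<subseteq> frontier \<Omega> \<longrightarrow> (\<forall>x\<in>e. v e x = 0)}"

definition Q_space :: "(real^'d) set set \<Rightarrow> (real^'d, real) pw set" where
  "Q_space T = {q \<in> (\<Pi>\<^sub>E K\<in>T. P0). (\<Sum>K\<in>T. LINT x|lebesgue_on K. q K x) = 0}"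

definition CR_space :: "(real^'d) set \<Rightarrow> (real^'d) set set \<Rightarrow> (real^'d, real^'d) pw set" where
  "CR_space \<Omega> T = {v \<in> V_space T. jump_free \<Omega> T (proj0 (\<lambda>K e. v K))}"

section \<open>Discrete problems\<close>

definition grad :: "(real^'d, real^'d) pw \<Rightarrow> (real^'d, real^'d^'d) pw" where
  "grad v K x = jacobian (v K) (at x)"

definition divg :: "(real^'d, real^'d) pw \<Rightarrow> (real^'d, real) pw" where
  "divg v K x = trace (jacobian (v K) (at x))"

definition normal_deriv :: "(real^'d, real^'d) pw \<Rightarrow> (real^'d) set \<Rightarrow> (real^'d, real^'d) pw" where
  "normal_deriv v K e x = frechet_derivative (v K) (at x) (outer_normal K e)"

definition hat_diff ::
    "(real^'d, real^'d) pw \<Rightarrow> (real^'d, real^'d) pw \<Rightarrow> (real^'d) set \<Rightarrow> (real^'d, real^'d) pw" where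
  "hat_diff vhat v K e x = vhat e x - v K x"

definition a_form ::
    "real \<Rightarrow> (real^'d) set set \<Rightarrow> (real^'d, real^'d) pw \<Rightarrow> (real^'d, real^'d) pw \<Rightarrow>
     (real^'d, real^'d) pw \<Rightarrow> (real^'d, real^'d) pw \<Rightarrow> real" where
  "a_form \<tau> T u uhat v vhat =
     vol_inner T (grad u) (grad v)
     + bdry_inner T (normal_deriv u) (hat_diff vhat v)
     + bdry_inner T (normal_deriv v) (hat_diff uhat u)
     + bdry_inner T (\<lambda>K e x. (\<tau> * inverse (diameter e)) *\<^sub>R proj0 (hat_diff uhat u) K e x)
         (proj0 (hat_diff vhat v))"

definition b_form ::
    "(real^'d) set set \<Rightarrow> (real^'d, real^'d) pw \<Rightarrow> (real^'d, real^'d) pw \<Rightarrow> (real^'d, real) pw \<Rightarrow> real" where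
  "b_form T v vhat p =
     - vol_inner T (divg v) p
     - bdry_inner T (hat_diff vhat v) (\<lambda>K e x. p K x *\<^sub>R outer_normal K e)"

definition HDG_solution ::
    "(real^'d) set \<Rightarrow> (real^'d) set set \<Rightarrow> real \<Rightarrow> (real^'d \<Rightarrow> real^'d) \<Rightarrow>
     (real^'d, real^'d) pw \<Rightarrow> (real^'d, real^'d) pw \<Rightarrow> (real^'d, real) pw \<Rightarrow> bool" where
  "HDG_solution \<Omega> T \<tau> f u uhat p \<longleftrightarrow>
     u \<in> V_space T \<and> uhat \<in> Vhat_space \<Omega> T \<and> p \<in> Q_space T \<and>
     (\<forall>v\<in>V_space T. \<forall>vhat\<in>Vhat_space \<Omega> T.
        a_form \<tau> T u uhat v vhat + b_form T v vhat p = vol_inner T (\<lambda>K. f) v) \<and>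
     (\<forall>q\<in>Q_space T. b_form T u uhat q = 0)"

definition CR_solution ::
    "(real^'d) set \<Rightarrow> (real^'d) set set \<Rightarrow> (real^'d \<Rightarrow> real^'d) \<Rightarrow>
     (real^'d, real^'d) pw \<Rightarrow> (real^'d, real) pw \<Rightarrow> bool" where
  "CR_solution \<Omega> T f u p \<longleftrightarrow>
     u \<in> CR_space \<Omega> T \<and> p \<in> Q_space T \<and>
     (\<forall>v\<in>CR_space \<Omega> T.
        vol_inner T (grad u) (grad v) - vol_inner T (divg v) p = vol_inner T (\<lambda>K. f) v) \<and>
     (\<forall>q\<in>Q_space T. vol_inner T (divg u) q = 0)"

section \<open>Crouzeix--Raviart interpolation\<close>

text \<open>Prescribing the facet integrals from both sides of an interior facet makes the
  interpolant continuous in the mean, i.e. a Crouzeix--Raviart function.\<close>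

definition CR_interp_scalar ::
    "'a::euclidean_space set set \<Rightarrow> ('a, real) pw \<Rightarrow> ('a, real) pw" where
  "CR_interp_scalar T vhat =
     (THE w. w \<in> (\<Pi>\<^sub>E K\<in>T. P1) \<and>
       (\<forall>K\<in>T. \<forall>e\<in>facets K.
          (LINT x|surface_measure e. w K x) = (LINT x|surface_measure e. vhat e x)))"

definition CR_interp :: "(real^'d) set set \<Rightarrow> (real^'d, real^'d) pw \<Rightarrow> (real^'d, real^'d) pw" where
  "CR_interp T vhat =
     (\<lambda>K\<in>T. \<lambda>x. \<chi> i. CR_interp_scalar T (\<lambda>e y. vhat e y $ i) K x)"

end

theory Submission
  imports Defs
begin

text \<open>A Crouzeix--Raviart function \<open>v\<close> together with its facet means \<open>vhat\<close> is an admissible test pair of the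
hybridized method, and for this pair the projected difference of \<open>vhat\<close> and \<open>v\<close> is zero. Of the boundary terms in the
bilinear form only the one with the normal derivative of \<open>v\<close> and the difference of \<open>uhat\<close> and \<open>u\<close> survives. The normal
derivative is constant on each facet, so \<open>uhat\<close> may be replaced by its interpolant \<open>w\<close>, which has the same facet means;
Green's formula on each cell then converts the boundary term into the gradient of \<open>w - u\<close>, and the whole form becomes the
product of the gradients of \<open>w\<close> and \<open>v\<close> (\<open>a_form_conforming_test\<close>). The same argument turns the divergence form of
\<open>(u, uhat)\<close> into that of \<open>w\<close> (\<open>b_form_facet_means\<close>). Hence \<open>(w, p)\<close> solves the Crouzeix--Raviart problem
(\<open>HDG_solves_CR\<close>), and the claim follows from the uniqueness of its solution (\<open>CR_solution_unique\<close>).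

For uniqueness, the velocity difference has zero gradient and is constant on each cell. Facet means are shared by
adjacent cells and vanish on the boundary, so the constants are zero once it is known that the cells are connected through
facets (\<open>mesh_facet_connected\<close>) and that some facet lies on the boundary (\<open>boundary_facet_exists\<close>). The pressure
difference is tested with a field that is concentrated on one interior facet (\<open>CR_bubble\<close>), which excludes jumps; being
constant with mean zero, it vanishes.

Green's formula is needed only for affine functions on a simplex (\<open>divergence_identity\<close>). In barycentric coordinates
it is a finite sum, given two facts about the surface measure of a facet: the volume of the simplex is area times height
divided by the dimension (\<open>area_volume\<close>), and the centroid of the facet is the average of its vertices (\<open>lam_centroid\<close>).
Since the surface measure is the Lebesgue measure of a prism, both are statements about linear changes of variables, and
both are reduced to the invariance of Lebesgue measure under oblique reflections
(\<open>distr_lborel_oblique_reflection\<close>).\<close>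

section \<open>Lebesgue measure under linear maps\<close>

lemma nn_integral_lborel_translate:
  fixes f :: "'a::euclidean_space \<Rightarrow> ennreal"
  assumes [measurable]: "f \<in> borel_measurable borel"
  shows "(\<integral>\<^sup>+x. f (x + w) \<partial>lborel) = (\<integral>\<^sup>+x. f x \<partial>lborel)"
proof -
  have "(\<integral>\<^sup>+x. f x \<partial>lborel) = (\<integral>\<^sup>+x. f x \<partial>distr lborel borel ((+) w))"
    by (simp add: lborel_distr_plus)
  also have "\<dots> = (\<integral>\<^sup>+x. f (x + w) \<partial>lborel)"
    by (subst nn_integral_distr) (auto simp: add.commute)
  finally show ?thesis ..
qed

lemma nn_integral_lborel_reflect:
  fixes f :: "'a::euclidean_space \<Rightarrow> ennreal"
  assumes [measurable]: "f \<in> borel_measurable borel"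
  shows "(\<integral>\<^sup>+x. f (w - x) \<partial>lborel) = (\<integral>\<^sup>+x. f x \<partial>lborel)"
proof -
  have "lborel = distr lborel borel (\<lambda>x::'a. w - x)"
    using lborel_affine[of "-1" w] by (simp add: density_1)
  then have "(\<integral>\<^sup>+x. f x \<partial>lborel) = (\<integral>\<^sup>+x. f x \<partial>distr lborel borel (\<lambda>x. w - x))"
    by simp
  also have "\<dots> = (\<integral>\<^sup>+x. f (w - x) \<partial>lborel)"
    by (subst nn_integral_distr) auto
  finally show ?thesis ..
qed

lemma linear_borel_measurable:
  fixes g :: "'a::euclidean_space \<Rightarrow> 'b::euclidean_space"
  assumes "linear g" shows "g \<in> borel_measurable borel"
  by (intro borel_measurable_continuous_onI linear_continuous_on linear_conv_bounded_linear[THEN iffD1] assms)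

text \<open>Lebesgue measure is scaled by a linear map. Fubini and translation invariance, applied to the integral
of \<open>1\<^sub>A (g x + y) 1\<^sub>B y\<close> over \<open>(x, y)\<close>, give this symmetric identity, so that the factor is the measure of
\<open>g -` B\<close> for any \<open>B\<close> of measure one. No determinant occurs: below, only ratios of volumes that are scaled by
the same factor are compared.\<close>

lemma emeasure_linear_vimage_cross:
  fixes g :: "'a::euclidean_space \<Rightarrow> 'a"
  assumes lin: "linear g" and surj: "surj g"
    and A[measurable]: "A \<in> sets borel" and B[measurable]: "B \<in> sets borel"
  shows "emeasure lborel (g -` A) * emeasure lborel B = emeasure lborel A * emeasure lborel (g -` B)"
proof -
  note [measurable] = linear_borel_measurable[OF lin]
  have meas: "g -` X \<in> sets borel" if "X \<in> sets borel" for X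
    using measurable_sets_borel[OF linear_borel_measurable[OF lin] that] .
  have shift: "(\<integral>\<^sup>+x. indicator A (g x + y) \<partial>lborel) = emeasure lborel (g -` A)" for y
  proof -
    obtain w where w: "y = g w" using surj by (metis surjD)
    have "(\<integral>\<^sup>+x. indicator A (g x + y) \<partial>lborel) = (\<integral>\<^sup>+x. indicator (g -` A) (x + w) \<partial>lborel)"
      by (intro nn_integral_cong) (simp add: indicator_def w linear_add[OF lin])
    also have "\<dots> = emeasure lborel (g -` A)"
      using meas[OF A] by (subst nn_integral_lborel_translate) auto
    finally show ?thesis .
  qed
  have reflect: "(\<integral>\<^sup>+x. indicator B (z - g x) \<partial>lborel) = emeasure lborel (g -` B)" for z
  proof -
    obtain w where w: "z = g w" using surj by (metis surjD)
    have "(\<integral>\<^sup>+x. indicator B (z - g x) \<partial>lborel) = (\<integral>\<^sup>+x. indicator (g -` B) (w - x) \<partial>lborel)"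
      by (intro nn_integral_cong) (simp add: indicator_def w linear_diff[OF lin])
    also have "\<dots> = emeasure lborel (g -` B)"
      using meas[OF B] by (subst nn_integral_lborel_reflect) auto
    finally show ?thesis .
  qed
  have "emeasure lborel (g -` A) * emeasure lborel B
      = (\<integral>\<^sup>+y. (\<integral>\<^sup>+x. indicator A (g x + y) \<partial>lborel) * indicator B y \<partial>lborel)"
    by (simp add: shift nn_integral_cmult)
  also have "\<dots> = (\<integral>\<^sup>+y. (\<integral>\<^sup>+x. indicator A (g x + y) * indicator B y \<partial>lborel) \<partial>lborel)"
    by (intro nn_integral_cong) (simp add: nn_integral_multc)
  also have "\<dots> = (\<integral>\<^sup>+x. (\<integral>\<^sup>+y. indicator A (g x + y) * indicator B y \<partial>lborel) \<partial>lborel)"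
    by (rule lborel_pair.Fubini') measurable
  also have "\<dots> = (\<integral>\<^sup>+x. (\<integral>\<^sup>+z. indicator A z * indicator B (z - g x) \<partial>lborel) \<partial>lborel)"
  proof (rule nn_integral_cong)
    fix x
    show "(\<integral>\<^sup>+y. (indicator A (g x + y) * indicator B y :: ennreal) \<partial>lborel)
        = (\<integral>\<^sup>+z. indicator A z * indicator B (z - g x) \<partial>lborel)"
      using nn_integral_lborel_translate[of "\<lambda>z. indicator A z * indicator B (z - g x)" "g x"]
      by (simp add: add.commute)
  qed
  also have "\<dots> = (\<integral>\<^sup>+z. (\<integral>\<^sup>+x. indicator A z * indicator B (z - g x) \<partial>lborel) \<partial>lborel)"
    by (rule lborel_pair.Fubini') measurable
  also have "\<dots> = emeasure lborel A * emeasure lborel (g -` B)"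
    by (simp add: nn_integral_cmult reflect nn_integral_multc)
  finally show ?thesis .
qed

text \<open>The square of the scaling factor of an involution is one.\<close>

lemma emeasure_linear_involution:
  fixes g :: "'a::euclidean_space \<Rightarrow> 'a"
  assumes lin: "linear g" and inv: "\<And>x. g (g x) = x" and A: "A \<in> sets borel"
  shows "emeasure lborel (g -` A) = emeasure lborel A"
proof -
  have surj: "surj g" by (metis inv surjI)
  define B :: "'a set" where "B = cbox 0 One"
  have meas: "g -` X \<in> sets borel" if "X \<in> sets borel" for X
    using measurable_sets_borel[OF linear_borel_measurable[OF lin] that] .
  have B: "B \<in> sets borel" "emeasure lborel B = 1"
    by (auto simp: B_def emeasure_lborel_cbox_eq)
  have gg: "g -` (g -` B) = B" by (auto simp: inv)
  have sq: "emeasure lborel (g -` B) * emeasure lborel (g -` B) = 1"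
    using emeasure_linear_vimage_cross[OF lin surj meas[OF B(1)] B(1)] B(2) by (simp add: gg)
  have "emeasure lborel (g -` B) = 1"
  proof -
    obtain r where r: "r \<ge> 0" "emeasure lborel (g -` B) = ennreal r"
    proof (cases "emeasure lborel (g -` B)")
      case top with sq show ?thesis by (simp add: ennreal_mult_eq_top_iff)
    qed auto
    with sq have "r * r = 1" by (simp flip: ennreal_mult ennreal_1)
    then have "r = 1 \<or> r = -1" by (simp flip: power2_eq_square add: power2_eq_1_iff)
    with r(1) have "r = 1" by auto
    with r show ?thesis by simp
  qed
  with emeasure_linear_vimage_cross[OF lin surj A B(1)] B(2) show ?thesis by simp
qed

text \<open>The reflection in the hyperplane \<open>a \<bullet> x + c = 0\<close> along \<open>q\<close>, which need not be orthogonal to the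
hyperplane. Two uses of it replace every explicit change of variables: it exchanges two vertices of a facet,
and it tilts the height of a simplex to an edge.\<close>

lemma distr_lborel_oblique_reflection:
  fixes a q :: "'a::euclidean_space"
  assumes aq: "a \<bullet> q = 2"
  shows "distr lborel borel (\<lambda>x. x - (a \<bullet> x + c) *\<^sub>R q) = lborel"
proof -
  define J where "J = (\<lambda>x. x - (a \<bullet> x) *\<^sub>R q)"
  have lin: "linear J"
    by (rule linearI) (auto simp: J_def algebra_simps inner_add_right)
  have inv: "J (J x) = x" for x
    by (simp add: J_def inner_diff_right aq algebra_simps)
  note [measurable] = linear_borel_measurable[OF lin]
  have "distr lborel borel J = lborel"
    by (intro measure_eqI) (auto simp: emeasure_distr emeasure_linear_involution[OF lin inv])
  then have "lborel = distr (distr lborel borel J) borel ((+) (- (c *\<^sub>R q)))"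
    by (simp add: lborel_distr_plus)
  also have "\<dots> = distr lborel borel (\<lambda>x. x - (a \<bullet> x + c) *\<^sub>R q)"
    by (subst distr_distr) (auto simp: comp_def J_def algebra_simps)
  finally show ?thesis ..
qed

text \<open>The prism over the standard simplex of dimension \<open>d - 1\<close>. Comparing its volume with the volume \<open>1 / d!\<close>
of the standard simplex of dimension \<open>d\<close> yields the factor \<open>d\<close> in the relation of volume, area and height.\<close>

lemma emeasure_std_prism:
  fixes k :: "'a::euclidean_space"
  assumes k: "k \<in> Basis" and s: "s \<ge> 0"
  shows "emeasure lborel {x. (\<forall>i\<in>Basis - {k}. 0 \<le> x \<bullet> i) \<and> (\<Sum>i\<in>Basis - {k}. x \<bullet> i) \<le> 1 \<and> \<bar>x \<bullet> k\<bar> \<le> s}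
     = ennreal (2 * s / fact (DIM('a) - 1))"
proof -
  define A where "A = Basis - {k}"
  define S where "S = {y :: 'a \<Rightarrow> real. (\<forall>i\<in>A. 0 \<le> y i) \<and> sum y A \<le> 1}"
  let ?M = "\<lambda>A. Pi\<^sub>M A (\<lambda>_::'a. lborel :: real measure)"
  interpret product_sigma_finite "\<lambda>_::'a. lborel :: real measure" by standard
  have BA: "Basis = insert k A" and kA: "k \<notin> A" and fA[simp]: "finite A"
    using k by (auto simp: A_def)
  have meas[measurable]: "S \<inter> space (?M A) \<in> sets (?M A)"
  proof -
    have "S \<inter> space (?M A) = Pi\<^sub>E A (\<lambda>_. {0..}) \<inter> (\<lambda>x. sum x A) -` {..1} \<inter> space (?M A)"
      by (auto simp: S_def space_PiM)
    also have "\<dots> \<in> sets (?M A)" by measurable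
    finally show ?thesis .
  qed
  have volS: "emeasure (?M A) (S \<inter> space (?M A)) = ennreal (1 / fact (DIM('a) - 1))"
    using emeasure_std_simplex_aux[OF fA, of 1] k by (simp add: S_def A_def divide_ennreal ennreal_fact flip: ennreal_1)
  define P where "P = {y :: 'a \<Rightarrow> real. (\<forall>i\<in>A. 0 \<le> y i) \<and> sum y A \<le> 1 \<and> \<bar>y k\<bar> \<le> s}"
  have upd: "x(k := y) \<in> P \<inter> space (?M Basis) \<longleftrightarrow> y \<in> {-s..s} \<and> x \<in> S" if "x \<in> space (?M A)" for x y
  proof -
    have "sum (x(k := y)) A = sum x A"
      using kA by (intro sum.cong) auto
    then show ?thesis using kA that
      by (auto simp: P_def S_def BA space_PiM PiE_def extensional_def)
  qed
  have measP: "P \<inter> space (?M Basis) \<in> sets (?M Basis)"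
  proof -
    have "P \<inter> space (?M Basis) = (\<Inter>i\<in>A. (\<lambda>x. x i) -` {0..} \<inter> space (?M Basis)) \<inter> 
        ((\<lambda>x. sum x A) -` {..1} \<inter> space (?M Basis)) \<inter> ((\<lambda>x. \<bar>x k\<bar>) -` {..s} \<inter> space (?M Basis))
        \<inter> space (?M Basis)"
      by (auto simp: P_def)
    also have "\<dots> \<in> sets (?M Basis)"
    proof (cases "A = {}")
      case True then show ?thesis using k by simp measurable
    next
      case False
      then show ?thesis using k 
        by (intro sets.Int sets.finite_INT measurable_sets[where A=borel]) (auto simp: BA intro!: measurable_sets borel_measurable_sum measurable_component_singleton)
    qed
    finally show ?thesis .
  qed
  have "emeasure lborel {x::'a. (\<forall>i\<in>Basis - {k}. 0 \<le> x \<bullet> i) \<and> (\<Sum>i\<in>Basis - {k}. x \<bullet> i) \<le> 1 \<and> \<bar>x \<bullet> k\<bar> \<le> s}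
      = emeasure (distr (?M Basis) borel (\<lambda>f. \<Sum>b\<in>Basis. f b *\<^sub>R b)) 
         {x. (\<forall>i\<in>A. 0 \<le> x \<bullet> i) \<and> (\<Sum>i\<in>A. x \<bullet> i) \<le> 1 \<and> \<bar>x \<bullet> k\<bar> \<le> s}"
    by (subst lborel_eq) (simp add: A_def)
  also have "\<dots> = emeasure (?M Basis) (P \<inter> space (?M Basis))"
  proof (subst emeasure_distr)
    show "{x. (\<forall>i\<in>A. 0 \<le> x \<bullet> i) \<and> (\<Sum>i\<in>A. x \<bullet> i) \<le> 1 \<and> \<bar>x \<bullet> k\<bar> \<le> s} \<in> sets borel"
    proof -
      have "{x::'a. (\<forall>i\<in>A. 0 \<le> x \<bullet> i) \<and> (\<Sum>i\<in>A. x \<bullet> i) \<le> 1 \<and> \<bar>x \<bullet> k\<bar> \<le> s}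
          = (\<Inter>i\<in>A. {x. 0 \<le> x \<bullet> i}) \<inter> {x. (\<Sum>i\<in>A. x \<bullet> i) \<le> 1} \<inter> {x. \<bar>x \<bullet> k\<bar> \<le> s}"
        by auto
      also have "closed \<dots>"
        by (intro closed_Int closed_INT ballI closed_Collect_le continuous_intros)
      finally show ?thesis by (rule borel_closed)
    qed
  next
    have "sum (\<lambda>i. y i) A = (\<Sum>i\<in>A. (\<Sum>b\<in>Basis. y b *\<^sub>R b) \<bullet> i)" for y
      by (intro sum.cong) (auto simp: A_def)
    then show "emeasure (?M Basis) ((\<lambda>f. \<Sum>b\<in>Basis. f b *\<^sub>R b) -`
        {x. (\<forall>i\<in>A. 0 \<le> x \<bullet> i) \<and> (\<Sum>i\<in>A. x \<bullet> i) \<le> 1 \<and> \<bar>x \<bullet> k\<bar> \<le> s} \<inter> space (?M Basis))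
      = emeasure (?M Basis) (P \<inter> space (?M Basis))"
      using k by (intro arg_cong[of _ _ "emeasure _"]) (auto simp: P_def A_def)
  qed measurable
  also have "\<dots> = (\<integral>\<^sup>+x. indicator (P \<inter> space (?M Basis)) x \<partial>?M (insert k A))"
    using measP by (simp add: BA)
  also have "\<dots> = (\<integral>\<^sup>+y. \<integral>\<^sup>+x. indicator (P \<inter> space (?M Basis)) (x(k := y)) \<partial>?M A \<partial>lborel)"
    using kA measP by (intro product_nn_integral_insert_rev) (auto simp: BA)
  also have "\<dots> = (\<integral>\<^sup>+y. \<integral>\<^sup>+x. indicator {-s..s} y * indicator (S \<inter> space (?M A)) x \<partial>?M A \<partial>lborel)"
    using upd by (intro nn_integral_cong) (auto simp: indicator_def)
  also have "\<dots> = (\<integral>\<^sup>+y. indicator {-s..s} y * ennreal (1 / fact (DIM('a) - 1)) \<partial>lborel)"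
    by (simp add: nn_integral_cmult volS)
  also have "\<dots> = ennreal (2 * s) * ennreal (1 / fact (DIM('a) - 1))"
    using s by (simp add: nn_integral_multc)
  also have "\<dots> = ennreal (2 * s / fact (DIM('a) - 1))"
    using s by (simp flip: ennreal_mult)
  finally show ?thesis .
qed

section \<open>The surface measure of a facet\<close>

definition area :: "'a::euclidean_space set \<Rightarrow> real" where
  "area e = measure (surface_measure e) UNIV"

definition centroid :: "'a::euclidean_space set \<Rightarrow> 'a" where
  "centroid e = (1 / area e) *\<^sub>R (LINT x|surface_measure e. x)"

definition facet_prism :: "'a::euclidean_space set \<Rightarrow> 'a set" where
  "facet_prism e = {x. closest_point (affine hull e) x \<in> e \<and>
     dist x (closest_point (affine hull e) x) \<le> 1/2}"

lemma continuous_closest_point_affine_hull: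
  fixes e :: "'a::euclidean_space set"
  assumes "e \<noteq> {}"
  shows "continuous_on A (closest_point (affine hull e))"
  using assms by (intro continuous_on_closest_point) (auto simp: affine_imp_convex)

lemma compact_facet_prism:
  fixes e :: "'a::euclidean_space set"
  assumes e: "compact e" "e \<noteq> {}"
  shows "compact (facet_prism e)"
proof -
  let ?p = "closest_point (affine hull e)"
  note c = continuous_closest_point_affine_hull[OF e(2)]
  have "closed (?p -` e)"
    using e c[of UNIV] by (intro closed_vimage) (auto simp: compact_imp_closed)
  moreover have "closed {x. dist x (?p x) \<le> 1/2}"
    by (intro closed_Collect_le continuous_intros c)
  moreover have "facet_prism e = ?p -` e \<inter> {x. dist x (?p x) \<le> 1/2}"
    by (auto simp: facet_prism_def)
  ultimately have "closed (facet_prism e)" by (simp add: closed_Int)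
  moreover have "bounded (facet_prism e)"
  proof -
    obtain r where r: "\<And>x. x \<in> e \<Longrightarrow> norm x \<le> r"
      using compact_imp_bounded[OF e(1)] by (auto simp: bounded_iff)
    have "norm x \<le> r + 1/2" if "x \<in> facet_prism e" for x
    proof -
      have "norm x \<le> norm (?p x) + dist x (?p x)"
        by (metis dist_norm norm_triangle_sub)
      then show ?thesis using that r[of "?p x"] by (auto simp: facet_prism_def)
    qed
    then show ?thesis by (auto simp: bounded_iff)
  qed
  ultimately show ?thesis by (simp add: compact_eq_bounded_closed)
qed

lemma surface_integral:
  fixes e :: "'a::euclidean_space set" and f :: "'a \<Rightarrow> 'b::euclidean_space"
  assumes e: "compact e" "e \<noteq> {}" and f: "continuous_on UNIV f"
  shows "integrable (surface_measure e) f" (is ?A)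
    and "(LINT x|surface_measure e. f x)
       = (LINT x|lborel. indicator (facet_prism e) x *\<^sub>R f (closest_point (affine hull e) x))" (is ?B)
proof -
  let ?p = "closest_point (affine hull e)" and ?S = "facet_prism e"
  have [measurable]: "?p \<in> borel_measurable borel" "f \<in> borel_measurable borel"
    using continuous_closest_point_affine_hull[OF e(2)] f by (auto intro: borel_measurable_continuous_onI)
  have S: "compact ?S" by (rule compact_facet_prism[OF e])
  then have [measurable]: "?S \<in> sets borel" by (simp add: compact_imp_closed borel_closed)
  have p: "?p \<in> measurable (lebesgue_on ?S) borel"
    by (intro measurable_restrict_space1 measurable_completion) simp
  have sm: "surface_measure e = distr (lebesgue_on ?S) borel ?p"
    by (simp add: surface_measure_def facet_prism_def Let_def)
  have fp: "continuous_on ?S (\<lambda>x. f (?p x))"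
    by (intro continuous_on_compose2[OF f] continuous_closest_point_affine_hull[OF e(2)]) auto
  have int: "integrable lborel (\<lambda>x. indicator ?S x *\<^sub>R f (?p x))"
    by (rule borel_integrable_compact[OF S fp])
  have Sl: "?S \<inter> space lebesgue \<in> sets lebesgue" by simp
  show ?A
    unfolding sm using int p
    by (subst integrable_distr_eq) (auto simp: integrable_restrict_space[OF Sl] integrable_completion)
  show ?B
    unfolding sm using p
    by (subst integral_distr) (auto simp: integral_restrict_space[OF Sl] integral_completion)
qed

lemma area_eq:
  fixes e :: "'a::euclidean_space set"
  assumes e: "compact e" "e \<noteq> {}"
  shows "area e = measure lborel (facet_prism e)"
    and "finite_measure (surface_measure e)"
proof -
  have "integrable (surface_measure e) (\<lambda>x. 1::real)"
    by (rule surface_integral[OF e]) simp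
  then show *: "finite_measure (surface_measure e)"
    by (auto simp: integrable_iff_bounded intro!: finite_measureI)
  have "(LINT x|surface_measure e. (1::real)) = (LINT x|lborel. indicator (facet_prism e) x *\<^sub>R (1::real))"
    by (rule surface_integral[OF e]) simp
  moreover have "facet_prism e \<in> sets lborel"
    using compact_facet_prism[OF e] by (simp add: compact_imp_closed borel_closed)
  ultimately show "area e = measure lborel (facet_prism e)"
    by (simp add: area_def surface_measure_def Let_def)
qed

text \<open>Affine functions are integrated exactly by one point evaluation, in the centroid. All boundary integrals
of the discrete problems are of this kind.\<close>

lemma surface_integral_affine:
  fixes e :: "'a::euclidean_space set" and A :: "'a \<Rightarrow> 'b::euclidean_space"
  assumes e: "compact e" "e \<noteq> {}" and pos: "area e > 0" and A: "linear A"
  shows "(LINT x|surface_measure e. A x + c) = area e *\<^sub>R (A (centroid e) + c)"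
proof -
  have bA: "bounded_linear A" using A by (simp add: linear_conv_bounded_linear)
  interpret finite_measure "surface_measure e" by (rule area_eq[OF e])
  have sp: "space (surface_measure e) = UNIV" by (simp add: surface_measure_def Let_def)
  have "integrable (surface_measure e) A"
    by (rule surface_integral[OF e]) (simp add: bA linear_continuous_on)
  then have "(LINT x|surface_measure e. A x + c) = (LINT x|surface_measure e. A x) + area e *\<^sub>R c"
    by (simp add: area_def sp)
  also have "(LINT x|surface_measure e. A x) = A (LINT x|surface_measure e. x)"
    by (intro integral_bounded_linear[OF bA] surface_integral[OF e] continuous_intros)
  also have "\<dots> = area e *\<^sub>R A (centroid e)"
    using pos by (simp add: centroid_def linear_scale[OF A])
  finally show ?thesis by (simp add: scaleR_add_right)
qed

text \<open>The factor is returned as an unknown, because it cancels where the lemma is used.\<close>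

lemma emeasure_affine_vimage:
  fixes L :: "'a::euclidean_space \<Rightarrow> 'a"
  assumes lin: "linear L" and surj: "surj L"
  obtains r where "\<And>A. A \<in> sets borel \<Longrightarrow> emeasure lborel ((\<lambda>x. p + L x) -` A) = r * emeasure lborel A"
proof
  fix A :: "'a set" assume A: "A \<in> sets borel"
  define B :: "'a set" where "B = cbox 0 One"
  have B: "B \<in> sets borel" "emeasure lborel B = 1"
    by (auto simp: B_def emeasure_lborel_cbox_eq)
  have A': "(+) p -` A \<in> sets borel"
    using measurable_sets_borel[of "(+) p" borel A] A by simp
  have "emeasure lborel A = emeasure (distr lborel borel ((+) p)) A"
    by (simp add: lborel_distr_plus)
  also have "\<dots> = emeasure lborel ((+) p -` A)"
    using A by (subst emeasure_distr) auto
  finally have "emeasure lborel ((+) p -` A) = emeasure lborel A" ..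
  moreover have "(\<lambda>x. p + L x) -` A = L -` ((+) p -` A)" by auto
  ultimately show "emeasure lborel ((\<lambda>x. p + L x) -` A) = emeasure lborel (L -` B) * emeasure lborel A"
    using emeasure_linear_vimage_cross[OF lin surj A' B(1)] B(2) by (simp add: mult.commute)
qed

section \<open>Barycentric coordinates\<close>

text \<open>A simplex with vertex set \<open>C\<close>. The barycentric coordinate of the vertex \<open>v\<close> is the affine function
with gradient \<open>g v\<close> and constant part \<open>b v\<close>; facets are indexed by their opposite vertex.\<close>

locale bary_simplex =
  fixes C :: "'a::euclidean_space set" and g :: "'a \<Rightarrow> 'a" and b :: "'a \<Rightarrow> real"
  assumes finC [simp]: "finite C" and cardC: "card C = Suc DIM('a)"
    and spanC: "affine hull C = UNIV"
    and bary: "\<And>v w. v \<in> C \<Longrightarrow> w \<in> C \<Longrightarrow> g v \<bullet> w + b v = (if v = w then 1 else 0)"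
begin

definition lam :: "'a \<Rightarrow> 'a \<Rightarrow> real" where "lam v x = g v \<bullet> x + b v"

lemma lam_vertex: "v \<in> C \<Longrightarrow> w \<in> C \<Longrightarrow> lam v w = (if v = w then 1 else 0)"
  by (simp add: lam_def bary)

lemma affine_combination:
  fixes a :: 'a
  assumes "sum u C = 1"
  shows "a \<bullet> (\<Sum>w\<in>C. u w *\<^sub>R w) + c = (\<Sum>w\<in>C. u w * (a \<bullet> w + c))"
  using assms by (simp add: inner_sum_right distrib_left sum.distrib flip: sum_distrib_right)

lemma lam_combination:
  assumes "sum u C = 1" "v \<in> C"
  shows "lam v (\<Sum>w\<in>C. u w *\<^sub>R w) = u v"
proof -
  have "lam v (\<Sum>w\<in>C. u w *\<^sub>R w) = (\<Sum>w\<in>C. u w * (if v = w then 1 else 0))"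
    unfolding lam_def affine_combination[OF assms(1)]
    by (intro sum.cong) (auto simp: bary assms(2))
  also have "\<dots> = (\<Sum>w\<in>C. if v = w then u w else 0)"
    by (intro sum.cong) auto
  also have "\<dots> = u v" using assms(2) by simp
  finally show ?thesis .
qed

lemma sum_lam: "(\<Sum>w\<in>C. lam w x) = 1" and lam_repr: "(\<Sum>w\<in>C. lam w x *\<^sub>R w) = x"
proof -
  have "x \<in> affine hull C" by (simp add: spanC)
  then obtain u where u: "sum u C = 1" "x = (\<Sum>w\<in>C. u w *\<^sub>R w)"
    by (auto simp: affine_hull_finite)
  then have eq: "lam w x = u w" if "w \<in> C" for w using lam_combination that by blast
  show "(\<Sum>w\<in>C. lam w x) = 1" using u(1) eq by simp
  show "(\<Sum>w\<in>C. lam w x *\<^sub>R w) = x" using u(2) eq by simp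
qed

lemma affine_expand:
  fixes a :: 'a
  shows "a \<bullet> x + c = (\<Sum>w\<in>C. lam w x * (a \<bullet> w + c))"
  using affine_combination[OF sum_lam[of x], of a c] by (simp add: lam_repr)

text \<open>The derivative of the expansion of an affine function in barycentric coordinates.\<close>

lemma gradient_from_vertices:
  fixes a :: 'a
  shows "(\<Sum>w\<in>C. (a \<bullet> w + c) *\<^sub>R g w) = a"
proof (rule vector_eq_rdot[THEN iffD1], rule allI)
  fix z
  have "a \<bullet> z = (a \<bullet> z + c) - (a \<bullet> 0 + c)" by simp
  also have "\<dots> = (\<Sum>w\<in>C. (lam w z - lam w 0) * (a \<bullet> w + c))"
    by (simp only: affine_expand[of a z] affine_expand[of a 0] left_diff_distrib sum_subtractf)
  also have "\<dots> = (\<Sum>w\<in>C. (a \<bullet> w + c) *\<^sub>R g w) \<bullet> z"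
    by (simp add: lam_def inner_sum_left mult.commute)
  finally show "(\<Sum>w\<in>C. (a \<bullet> w + c) *\<^sub>R g w) \<bullet> z = a \<bullet> z" ..
qed

lemma sum_g: "(\<Sum>w\<in>C. g w) = 0"
  using gradient_from_vertices[of 0 1] by simp

lemma hull_eq: "convex hull C = {x. \<forall>w\<in>C. 0 \<le> lam w x}"
proof -
  have "x \<in> convex hull C \<longleftrightarrow> (\<forall>w\<in>C. 0 \<le> lam w x)" for x
  proof
    assume "x \<in> convex hull C"
    then obtain u where "\<forall>w\<in>C. 0 \<le> u w" "sum u C = 1" "(\<Sum>w\<in>C. u w *\<^sub>R w) = x"
      by (auto simp: convex_hull_finite)
    then show "\<forall>w\<in>C. 0 \<le> lam w x" using lam_combination by auto
  next
    assume "\<forall>w\<in>C. 0 \<le> lam w x"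
    then show "x \<in> convex hull C"
      using sum_lam lam_repr by (auto simp: convex_hull_finite intro!: exI[of _ "\<lambda>w. lam w x"])
  qed
  then show ?thesis by auto
qed

lemma face_eq:
  assumes v: "v \<in> C"
  shows "convex hull (C - {v}) = {x. lam v x = 0 \<and> (\<forall>w\<in>C. 0 \<le> lam w x)}"
proof -
  have "x \<in> convex hull (C - {v}) \<longleftrightarrow> lam v x = 0 \<and> (\<forall>w\<in>C. 0 \<le> lam w x)" for x
  proof
    assume "x \<in> convex hull (C - {v})"
    then obtain u where u: "\<forall>w\<in>C-{v}. 0 \<le> u w" "sum u (C-{v}) = 1" "(\<Sum>w\<in>C-{v}. u w *\<^sub>R w) = x"
      by (auto simp: convex_hull_finite)
    define u' where "u' = (\<lambda>w. if w = v then 0 else u w)"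
    have "sum u' C = 1" "(\<Sum>w\<in>C. u' w *\<^sub>R w) = x"
      using u v by (auto simp: u'_def sum.remove[OF finC v])
    then have "lam w x = u' w" if "w \<in> C" for w using lam_combination that by auto
    then show "lam v x = 0 \<and> (\<forall>w\<in>C. 0 \<le> lam w x)" using u(1) v by (auto simp: u'_def)
  next
    assume x: "lam v x = 0 \<and> (\<forall>w\<in>C. 0 \<le> lam w x)"
    then show "x \<in> convex hull (C - {v})"
      using sum_lam[of x] lam_repr[of x]
      by (auto simp: convex_hull_finite sum.remove[OF finC v] intro!: exI[of _ "\<lambda>w. lam w x"])
  qed
  then show ?thesis by auto
qed

lemma face_nonempty: 
  assumes v: "v \<in> C" shows "C - {v} \<noteq> {}"
proof
  assume "C - {v} = {}"
  then have "card C \<le> card {v}" by (intro card_mono) auto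
  then show False using cardC by simp
qed

lemma g_nonzero: assumes v: "v \<in> C" shows "g v \<noteq> 0"
proof
  assume "g v = 0"
  obtain w where "w \<in> C" "w \<noteq> v" using face_nonempty[OF v] by auto
  with bary[OF v v] bary[OF v, of w] \<open>g v = 0\<close> show False by auto
qed

lemma affine_hull_face:
  assumes v: "v \<in> C"
  shows "affine hull (convex hull (C - {v})) = {x. lam v x = 0}"
proof -
  have "x \<in> affine hull (C - {v}) \<longleftrightarrow> lam v x = 0" for x
  proof
    assume "x \<in> affine hull (C - {v})"
    then obtain u where u: "sum u (C-{v}) = 1" "(\<Sum>w\<in>C-{v}. u w *\<^sub>R w) = x"
      by (auto simp: affine_hull_finite)
    define u' where "u' = (\<lambda>w. if w = v then 0 else u w)"
    have "sum u' C = 1" "(\<Sum>w\<in>C. u' w *\<^sub>R w) = x"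
      using u v by (auto simp: u'_def sum.remove[OF finC v])
    then show "lam v x = 0" using lam_combination[of u' v] v by (auto simp: u'_def)
  next
    assume "lam v x = 0"
    then show "x \<in> affine hull (C - {v})"
      using sum_lam[of x] lam_repr[of x]
      by (auto simp: affine_hull_finite sum.remove[OF finC v] intro!: exI[of _ "\<lambda>w. lam w x"])
  qed
  then show ?thesis by auto
qed

text \<open>The orthogonal projection to the hyperplane of the facet opposite to \<open>v\<close>.\<close>

definition pr :: "'a \<Rightarrow> 'a \<Rightarrow> 'a" where
  "pr v x = x - (lam v x / (g v \<bullet> g v)) *\<^sub>R g v"

lemma closest_point_face:
  assumes v: "v \<in> C"
  shows "closest_point (affine hull (convex hull (C - {v}))) x = pr v x"
proof -
  have gg: "g v \<bullet> g v \<noteq> 0" using g_nonzero[OF v] by simp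
  have mem: "pr v x \<in> {x. lam v x = 0}"
    using gg by (simp add: pr_def lam_def inner_diff_right)
  have "dist x (pr v x) \<le> dist x y" if "lam v y = 0" for y
  proof -
    have "g v \<bullet> (pr v x - y) = lam v (pr v x) - lam v y" by (simp add: lam_def inner_diff_right)
    then have orth: "g v \<bullet> (pr v x - y) = 0" using mem that by simp
    have "orthogonal (x - pr v x) (pr v x - y)"
      using orth by (simp add: orthogonal_def pr_def)
    then have "(norm (x - pr v x + (pr v x - y)))\<^sup>2 = (norm (x - pr v x))\<^sup>2 + (norm (pr v x - y))\<^sup>2"
      by (rule norm_add_Pythagorean)
    then have "(dist x y)\<^sup>2 \<ge> (dist x (pr v x))\<^sup>2" by (simp add: dist_norm)
    then show ?thesis by (simp add: abs_le_square_iff[symmetric])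
  qed
  then have "\<forall>z\<in>affine hull (convex hull (C - {v})). dist x (pr v x) \<le> dist x z"
    unfolding affine_hull_face[OF v] by auto
  moreover have "pr v x \<in> affine hull (convex hull (C - {v}))"
    unfolding affine_hull_face[OF v] by (rule mem)
  ultimately show ?thesis
    by (intro closest_point_unique[symmetric]) (auto simp: affine_imp_convex)
qed

text \<open>The barycentric coordinates of the projected point. They are again affine, with gradients \<open>gp\<close>
tangential to the facet, and describe the prism over the facet by linear inequalities.\<close>

definition lamp :: "'a \<Rightarrow> 'a \<Rightarrow> 'a \<Rightarrow> real" where
  "lamp v w x = lam w (pr v x)"

definition gp :: "'a \<Rightarrow> 'a \<Rightarrow> 'a" where
  "gp v w = g w - ((g v \<bullet> g w) / (g v \<bullet> g v)) *\<^sub>R g v"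

lemma lamp_add: "lamp v w (x + y) = lamp v w x + gp v w \<bullet> y"
  by (simp add: lamp_def gp_def lam_def pr_def algebra_simps add_divide_distrib inner_commute)

lemma lamp_alt: "lamp v w x = lam w x - lam v x * ((g v \<bullet> g w) / (g v \<bullet> g v))"
  by (simp add: lamp_def lam_def pr_def algebra_simps inner_commute)

lemma prism_eq:
  assumes v: "v \<in> C"
  shows "facet_prism (convex hull (C - {v})) =
     {x. \<bar>lam v x\<bar> \<le> norm (g v) / 2 \<and> (\<forall>w\<in>C - {v}. 0 \<le> lamp v w x)}"
proof -
  have gg: "g v \<bullet> g v \<noteq> 0" using g_nonzero[OF v] by simp
  have 0: "lam v (pr v x) = 0" for x
    using gg by (simp add: pr_def lam_def inner_diff_right)
  have d: "dist x (pr v x) = \<bar>lam v x\<bar> / norm (g v)" for x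
    by (simp add: pr_def dist_norm power2_eq_square flip: power2_norm_eq_inner)
  have "dist x (pr v x) \<le> 1/2 \<longleftrightarrow> \<bar>lam v x\<bar> \<le> norm (g v) / 2" for x
    unfolding d using g_nonzero[OF v] by (simp add: field_simps)
  moreover have "(\<forall>w\<in>C. 0 \<le> lam w (pr v x)) \<longleftrightarrow> (\<forall>w\<in>C - {v}. 0 \<le> lamp v w x)" for x
  proof -
    have "(\<forall>w\<in>insert v (C - {v}). 0 \<le> lam w (pr v x)) \<longleftrightarrow> (\<forall>w\<in>C - {v}. 0 \<le> lamp v w x)"
      unfolding ball_simps lamp_def 0 by simp
    then show ?thesis unfolding insert_Diff[OF v] .
  qed
  ultimately show ?thesis
    unfolding facet_prism_def closest_point_face[OF v]
    unfolding face_eq[OF v] by (simp add: 0 conj_commute)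
qed

lemma compact_face: "compact (convex hull (C - {v}))" 
  by (simp add: finite_imp_compact_convex_hull)

lemma hull_face_nonempty: "v \<in> C \<Longrightarrow> convex hull (C - {v}) \<noteq> {}"
  using face_nonempty by simp

text \<open>The oblique reflection that exchanges the vertices \<open>j\<close> and \<open>k\<close> maps the prism over the facet to
itself, and exchanges the two coordinates.\<close>

lemma surface_integral_lam_swap:
  assumes v: "v \<in> C" and j: "j \<in> C - {v}" and k: "k \<in> C - {v}"
  shows "(LINT x|surface_measure (convex hull (C - {v})). lam j x)
       = (LINT x|surface_measure (convex hull (C - {v})). lam k x)"
proof (cases "j = k")
  case False
  let ?S = "facet_prism (convex hull (C - {v}))"
  let ?q = "j - k" and ?a = "gp v j - gp v k" and ?c = "lamp v j 0 - lamp v k 0"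
  define T where "T = (\<lambda>x. x - (?a \<bullet> x + ?c) *\<^sub>R ?q)"
  have gv: "g v \<bullet> ?q = 0"
    using bary[OF v, of j] bary[OF v, of k] j k by (auto simp: inner_diff_right)
  have gw: "g w \<bullet> ?q = (if w = j then 1 else if w = k then -1 else 0)" if "w \<in> C" for w
    using bary[OF that, of j] bary[OF that, of k] j k False by (auto simp: inner_diff_right split: if_splits)
  have gpq: "gp v w \<bullet> ?q = g w \<bullet> ?q" for w
    using gv by (simp add: gp_def inner_diff_left)
  have aq: "?a \<bullet> ?q = 2"
    using gw[of j] gw[of k] j k False gpq[of j] gpq[of k] by (simp only: inner_diff_left) auto
  have d: "?a \<bullet> x + ?c = lamp v j x - lamp v k x" for x
    using lamp_add[of v j 0 x] lamp_add[of v k 0 x] by (simp add: inner_diff_left)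
  have T: "T x = x + (- (lamp v j x - lamp v k x)) *\<^sub>R ?q" for x
    unfolding T_def d scaleR_minus_left by simp
  have lampT: "lamp v w (T x) = lamp v w x - (lamp v j x - lamp v k x) * (g w \<bullet> ?q)" for w x
    unfolding T lamp_add inner_scaleR_right gpq by (simp add: algebra_simps)
  have lamT: "lam v (T x) = lam v x" for x
    using gv by (simp add: T lam_def inner_diff_right inner_add_right)
  have ST: "T x \<in> ?S \<longleftrightarrow> x \<in> ?S" for x
  proof -
    have "(\<forall>w\<in>C-{v}. 0 \<le> lamp v w (T x)) \<longleftrightarrow> (\<forall>w\<in>C-{v}. 0 \<le> lamp v w x)"
    proof -
      have "lamp v w (T x) = (if w = j then lamp v k x else if w = k then lamp v j x else lamp v w x)"
        if "w \<in> C - {v}" for w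
        using that by (simp only: lampT gw DiffD1) (simp split: if_splits)
      then show ?thesis using j k by (metis (full_types))
    qed
    then show ?thesis by (simp add: prism_eq[OF v] lamT)
  qed
  have cont: "continuous_on UNIV (lam w)" for w
    unfolding lam_def by (intro continuous_intros)
  have contp: "continuous_on UNIV (lamp v w)" for w
    unfolding lamp_def pr_def lam_def using g_nonzero[OF v] by (intro continuous_intros) auto
  have [measurable]: "?S \<in> sets borel"
    using compact_facet_prism[OF compact_face hull_face_nonempty[OF v]] by (simp add: compact_imp_closed borel_closed)
  have [measurable]: "lamp v w \<in> borel_measurable borel" for w
    using contp by (rule borel_measurable_continuous_onI)
  have [measurable]: "T \<in> borel_measurable borel"
    unfolding T_def by measurable
  have "(LINT x|surface_measure (convex hull (C - {v})). lam j x)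
      = (LINT x|lborel. indicator ?S x *\<^sub>R lamp v j x)"
    using surface_integral(2)[OF compact_face hull_face_nonempty[OF v] cont]
    unfolding closest_point_face[OF v] lamp_def by simp
  also have "\<dots> = (LINT x|distr lborel borel T. indicator ?S x *\<^sub>R lamp v j x)"
    unfolding T_def distr_lborel_oblique_reflection[OF aq] ..
  also have "\<dots> = (LINT x|lborel. indicator ?S (T x) *\<^sub>R lamp v j (T x))"
    by (subst integral_distr) auto
  also have "\<dots> = (LINT x|lborel. indicator ?S x *\<^sub>R lamp v k x)"
    using gw[of j] j by (intro Bochner_Integration.integral_cong) (auto simp: lampT ST indicator_def)
  also have "\<dots> = (LINT x|surface_measure (convex hull (C - {v})). lam k x)"
    using surface_integral(2)[OF compact_face hull_face_nonempty[OF v] cont]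
    unfolding closest_point_face[OF v] lamp_def by simp
  finally show ?thesis .
qed simp

text \<open>The factor \<open>norm (g v)\<close> is the reciprocal of the height over the facet. One affine map \<open>F\<close> pulls the prism over the facet back to a prism over the standard simplex. Composed with the
oblique reflection \<open>J\<close>, which takes the height to the edge from \<open>p\<close> to \<open>v\<close>, the same map pulls the simplex back to
the standard simplex. Since \<open>J\<close> preserves the measure, both volumes are scaled by the same factor \<open>r\<close>.\<close>

lemma area_volume:
  assumes v: "v \<in> C"
  shows "area (convex hull (C - {v})) = DIM('a) * norm (g v) * measure lborel (convex hull C)"
    and "measure lborel (convex hull C) > 0"
proof -
  let ?K = "convex hull C" and ?S = "facet_prism (convex hull (C - {v}))"
  obtain p where p: "p \<in> C" "p \<noteq> v" "v \<noteq> p" using face_nonempty[OF v] by auto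
  obtain k :: 'a where k: "k \<in> Basis" using nonempty_Basis by blast
  define A where "A = Basis - {k}"
  have fA: "finite A" by (simp add: A_def)
  have "card A = card (C - {v} - {p})" using k v p cardC by (simp add: A_def)
  then obtain \<beta> where \<beta>: "bij_betw \<beta> A (C - {v} - {p})"
    using fA finC by (metis finite_Diff finite_same_card_bij)
  have \<beta>C: "\<beta> i \<in> C" "\<beta> i \<noteq> v" "\<beta> i \<noteq> p" if "i \<in> A" for i
    using \<beta> that by (auto simp: bij_betw_def)
  have \<beta>inj: "\<beta> i = \<beta> j \<longleftrightarrow> i = j" if "i \<in> A" "j \<in> A" for i j
    using \<beta> that by (auto simp: bij_betw_def inj_on_def)
  have Ceq: "C = insert v (insert p (\<beta> ` A))"
    using \<beta> v p by (auto simp: bij_betw_def)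
  have gg: "g v \<bullet> g v \<noteq> 0" using g_nonzero[OF v] by simp
  \<comment> \<open>the height vector, pointing out of the simplex\<close>
  define m where "m = - (1 / (g v \<bullet> g v)) *\<^sub>R g v"
  have gm: "g v \<bullet> m = -1" using gg by (simp add: m_def)
  define L where "L = (\<lambda>x. (\<Sum>i\<in>A. (x \<bullet> i) *\<^sub>R (\<beta> i - p)) + (x \<bullet> k) *\<^sub>R m)"
  have linL: "linear L"
    by (rule linearI)
       (auto simp: L_def inner_add_left scaleR_add_left sum.distrib scaleR_sum_right scaleR_add_right ac_simps)
  have edge: "g w \<bullet> (w' - p) = (if w = w' then 1 else 0) - (if w = p then 1 else 0)"
    if "w \<in> C" "w' \<in> C" for w w'
    using bary[OF that] bary[OF that(1), of p] p by (auto simp: inner_diff_right split: if_splits)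
  have gL: "g w \<bullet> L x = (\<Sum>i\<in>A. (x \<bullet> i) * (g w \<bullet> (\<beta> i - p))) + (x \<bullet> k) * (g w \<bullet> m)" for w x
    by (simp add: L_def inner_add_right inner_sum_right)
  have sum_v: "(\<Sum>i\<in>A. (x \<bullet> i) * (g v \<bullet> (\<beta> i - p))) = 0" for x
  proof (intro sum.neutral ballI)
    fix i assume "i \<in> A"
    then show "(x \<bullet> i) * (g v \<bullet> (\<beta> i - p)) = 0"
      using edge[OF v \<beta>C(1)] \<beta>C(2)[of i] p by auto
  qed
  have sum_\<beta>: "(\<Sum>i\<in>A. (x \<bullet> i) * (g (\<beta> j) \<bullet> (\<beta> i - p))) = x \<bullet> j" if j: "j \<in> A" for j x
  proof -
    have "(\<Sum>i\<in>A. (x \<bullet> i) * (g (\<beta> j) \<bullet> (\<beta> i - p))) = (\<Sum>i\<in>A. if i = j then x \<bullet> i else 0)"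
    proof (intro sum.cong refl)
      fix i assume "i \<in> A"
      then show "(x \<bullet> i) * (g (\<beta> j) \<bullet> (\<beta> i - p)) = (if i = j then x \<bullet> i else 0)"
        using edge[OF \<beta>C(1)[OF j] \<beta>C(1)[of i]] \<beta>C(3)[OF j] \<beta>inj[OF j, of i] by auto
    qed
    then show ?thesis using j fA by simp
  qed
  have sum_p: "(\<Sum>i\<in>A. (x \<bullet> i) * (g p \<bullet> (\<beta> i - p))) = - (\<Sum>i\<in>A. x \<bullet> i)" for x
    unfolding sum_negf[symmetric]
  proof (intro sum.cong refl)
    fix i assume "i \<in> A"
    then show "(x \<bullet> i) * (g p \<bullet> (\<beta> i - p)) = - (x \<bullet> i)"
      using edge[of p "\<beta> i"] \<beta>C[of i] p by auto
  qed
  have gvL: "g v \<bullet> L x = - (x \<bullet> k)" for x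
    by (simp add: gL gm sum_v)
  have g\<beta>L: "g (\<beta> j) \<bullet> L x = x \<bullet> j + (x \<bullet> k) * (g (\<beta> j) \<bullet> m)" if j: "j \<in> A" for j x
    by (simp add: gL sum_\<beta>[OF j])
  have gpL: "g p \<bullet> L x = - (\<Sum>i\<in>A. x \<bullet> i) + (x \<bullet> k) * (g p \<bullet> m)" for x
    by (simp add: gL sum_p)
  have surjL: "surj L"
  proof (rule linear_injective_imp_surjective[OF linL])
    show "inj L"
    proof (subst linear_injective_0[OF linL], intro allI impI)
      fix x assume "L x = 0"
      then have "x \<bullet> k = 0" "\<And>j. j \<in> A \<Longrightarrow> x \<bullet> j = 0"
        using gvL[of x] g\<beta>L[of _ x] by auto
      then show "x = 0" by (intro euclidean_eqI[of x 0]) (auto simp: A_def)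
    qed
  qed simp
  obtain r where r: "\<And>X. X \<in> sets borel \<Longrightarrow> emeasure lborel ((\<lambda>x. p + L x) -` X) = r * emeasure lborel X"
    using emeasure_affine_vimage[OF linL surjL, of p] by blast
  define F where "F = (\<lambda>x. p + L x)"
  have lamF: "lam w (F x) = lam w p + g w \<bullet> L x" for w x
    by (simp add: lam_def F_def inner_add_right)
  have lamvF: "lam v (F x) = - (x \<bullet> k)" for x
    using lam_vertex[of v p] v p by (simp add: lamF gvL)
  have lampF: "lamp v w (F x) = lam w p + g w \<bullet> L x - (x \<bullet> k) * (g w \<bullet> m)" for w x
    unfolding lamp_alt lamvF by (simp add: lamF m_def inner_commute)
  have prism: "F -` ?S = {x. (\<forall>i\<in>A. 0 \<le> x \<bullet> i) \<and> (\<Sum>i\<in>A. x \<bullet> i) \<le> 1 \<and> \<bar>x \<bullet> k\<bar> \<le> norm (g v) / 2}"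
  proof -
    have "lamp v (\<beta> i) (F x) = x \<bullet> i" if "i \<in> A" for i x
      using lam_vertex[of "\<beta> i" p] \<beta>C[OF that] p that by (simp add: lampF g\<beta>L)
    moreover have "lamp v p (F x) = 1 - (\<Sum>i\<in>A. x \<bullet> i)" for x
      using lam_vertex[of p p] p by (simp add: lampF gpL)
    moreover have "C - {v} = insert p (\<beta> ` A)" using Ceq v p \<beta>C by auto
    ultimately show ?thesis
      unfolding prism_eq[OF v] by (auto simp: lamvF)
  qed
  have Kc: "compact ?K" by (simp add: finite_imp_compact_convex_hull)
  have Sc: "compact ?S" by (rule compact_facet_prism[OF compact_face hull_face_nonempty[OF v]])
  have [measurable]: "?K \<in> sets borel" "?S \<in> sets borel"
    using Kc Sc by (auto simp: compact_imp_closed borel_closed)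
  have eS: "emeasure lborel ?S = ennreal (area (convex hull (C - {v})))"
    using area_eq(1)[OF compact_face hull_face_nonempty[OF v]] emeasure_eq_ennreal_measure[of lborel ?S]
      emeasure_compact_finite[OF Sc] by (simp add: top.not_eq_extremum)
  have eK: "emeasure lborel ?K = ennreal (measure lborel ?K)"
    using emeasure_eq_ennreal_measure[of lborel ?K] emeasure_compact_finite[OF Kc] by (simp add: top.not_eq_extremum)
  have volS: "r * ennreal (area (convex hull (C - {v}))) = ennreal (norm (g v) / fact (DIM('a) - 1))"
    using r[of ?S] emeasure_std_prism[OF k, of "norm (g v) / 2"]
    by (simp add: eS A_def prism[unfolded F_def A_def])
  \<comment> \<open>The reflection along this direction maps the height \<open>m\<close> to the edge \<open>v - p\<close>.\<close>
  define q where "q = m - (v - p)"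
  have aq: "- g v \<bullet> q = 2"
    using edge[OF v v] p by (simp add: q_def inner_diff_right gm)
  define J where "J = (\<lambda>x. x - (- g v \<bullet> x + - b v) *\<^sub>R q)"
  have JF: "J (F x) = p + (\<Sum>i\<in>A. (x \<bullet> i) *\<^sub>R (\<beta> i - p)) + (x \<bullet> k) *\<^sub>R (v - p)" for x
  proof -
    have "J (F x) = F x + lam v (F x) *\<^sub>R q" by (simp add: J_def lam_def algebra_simps)
    then show ?thesis unfolding lamvF by (simp add: F_def L_def q_def algebra_simps)
  qed
  have std: "F -` (J -` ?K) = convex hull (insert 0 Basis)"
  proof -
    have lJF: "lam w (J (F x)) = lam w p + (\<Sum>i\<in>A. (x \<bullet> i) * (g w \<bullet> (\<beta> i - p))) + (x \<bullet> k) * (g w \<bullet> (v - p))" for w x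
      by (simp add: JF lam_def inner_add_right inner_sum_right)
    have "lam (\<beta> j) (J (F x)) = x \<bullet> j" if j: "j \<in> A" for j x
      using edge[OF \<beta>C(1)[OF j] v] lam_vertex[OF \<beta>C(1)[OF j], of p] p \<beta>C[OF j]
      by (simp add: lJF sum_\<beta>[OF j])
    moreover have "lam v (J (F x)) = x \<bullet> k" for x
      using edge[OF v v] lam_vertex[OF v, of p] p by (auto simp: lJF sum_v)
    moreover have "lam p (J (F x)) = 1 - (\<Sum>i\<in>Basis. x \<bullet> i)" for x
    proof -
      have "(\<Sum>i\<in>Basis. x \<bullet> i) = x \<bullet> k + (\<Sum>i\<in>A. x \<bullet> i)"
        unfolding A_def using k by (intro sum.remove) auto
      then show ?thesis using edge[of p v] lam_vertex[of p p] p v by (simp add: lJF sum_p)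
    qed
    moreover have "(\<forall>w\<in>C. Q w) \<longleftrightarrow> Q v \<and> Q p \<and> (\<forall>i\<in>A. Q (\<beta> i))" for Q
      by (subst Ceq) auto
    moreover have "(\<forall>i\<in>Basis. Q i) \<longleftrightarrow> Q k \<and> (\<forall>i\<in>A. Q i)" for Q
      using k by (auto simp: A_def)
    ultimately have "F -` (J -` ?K) = {x. (\<forall>i\<in>Basis. 0 \<le> x \<bullet> i) \<and> (\<Sum>i\<in>Basis. x \<bullet> i) \<le> 1}"
      unfolding hull_eq by auto
    then show ?thesis by (simp add: std_simplex)
  qed
  have [measurable]: "J \<in> borel_measurable borel" unfolding J_def by measurable
  have "J -` ?K \<in> sets borel"
    using measurable_sets_borel[of J borel ?K] by simp
  then have "ennreal (1 / fact DIM('a)) = r * emeasure lborel (J -` ?K)"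
    using r[of "J -` ?K"] std emeasure_std_simplex[where 'a = 'a] by (simp add: F_def)
  also have "emeasure lborel (J -` ?K) = emeasure (distr lborel borel J) ?K"
    by (subst emeasure_distr) auto
  also have "\<dots> = ennreal (measure lborel ?K)"
    unfolding J_def distr_lborel_oblique_reflection[OF aq] by (rule eK)
  finally have volK: "r * ennreal (measure lborel ?K) = ennreal (1 / fact DIM('a))" ..
  have "r \<noteq> top"
  proof
    assume "r = top"
    with volK have "measure lborel ?K = 0"
      by (cases "measure lborel ?K = 0") (auto simp: ennreal_top_mult split: if_splits)
    with volK show False by simp
  qed
  then obtain s where s: "s \<ge> 0" "r = ennreal s" by (cases r) auto
  have sK: "s * measure lborel ?K = 1 / fact DIM('a)"
    using volK s by (simp flip: ennreal_mult)
  have ar: "area (convex hull (C - {v})) \<ge> 0" by (simp add: area_def)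
  have sS: "s * area (convex hull (C - {v})) = norm (g v) / fact (DIM('a) - 1)"
    using volS s ar by (simp flip: ennreal_mult)
  have s0: "s \<noteq> 0" using sK by auto
  have "s * measure lborel ?K > 0" unfolding sK by simp
  then show "measure lborel ?K > 0" using s(1) by (simp add: zero_less_mult_iff)
  have "fact DIM('a) = real DIM('a) * fact (DIM('a) - 1)"
    by (rule fact_reduce) simp
  then have "s * area (convex hull (C - {v})) = s * (DIM('a) * norm (g v) * measure lborel ?K)"
    using sK unfolding sS by (simp add: field_simps)
  then show "area (convex hull (C - {v})) = DIM('a) * norm (g v) * measure lborel ?K"
    using s0 by simp
qed

lemma area_pos: "v \<in> C \<Longrightarrow> area (convex hull (C - {v})) > 0"
  using area_volume[of v] g_nonzero[of v] by simp

text \<open>By symmetry the coordinates of all vertices of the facet have the same mean, and these means add up to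
one: the centroid is the average of the vertices.\<close>

lemma lam_centroid:
  assumes v: "v \<in> C" and w: "w \<in> C"
  shows "lam w (centroid (convex hull (C - {v}))) = (if w = v then 0 else 1 / DIM('a))"
proof -
  let ?e = "convex hull (C - {v})"
  have int: "(LINT x|surface_measure ?e. lam j x) = area ?e * lam j (centroid ?e)" for j
    using surface_integral_affine[OF compact_face hull_face_nonempty[OF v] area_pos[OF v], of "\<lambda>x. g j \<bullet> x" "b j"]
    by (simp add: lam_def bounded_linear_inner_right bounded_linear.linear)
  have same: "lam j (centroid ?e) = lam k (centroid ?e)" if "j \<in> C - {v}" "k \<in> C - {v}" for j k
    using surface_integral_lam_swap[OF v that] area_pos[OF v] by (simp add: int)
  have gg: "g v \<bullet> g v \<noteq> 0" using g_nonzero[OF v] by simp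
  have "lam v (pr v x) = 0" for x
    using gg by (simp add: pr_def lam_def inner_diff_right)
  moreover have "continuous_on UNIV (lam v)" unfolding lam_def by (intro continuous_intros)
  ultimately have "(LINT x|surface_measure ?e. lam v x) = 0"
    using surface_integral(2)[OF compact_face hull_face_nonempty[OF v], of "lam v"]
    unfolding closest_point_face[OF v] by simp
  then have v0: "lam v (centroid ?e) = 0" using area_pos[OF v] by (simp add: int)
  show ?thesis
  proof (cases "w = v")
    case False
    have "1 = (\<Sum>j\<in>C - {v}. lam j (centroid ?e))"
      using sum_lam[of "centroid ?e"] v0 by (simp add: sum.remove[OF finC v])
    also have "\<dots> = (\<Sum>j\<in>C - {v}. lam w (centroid ?e))"
      by (intro sum.cong refl same) (use False w in auto)
    also have "\<dots> = DIM('a) * lam w (centroid ?e)"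
      using v cardC by simp
    finally show ?thesis using False by (simp add: field_simps)
  qed (simp add: v0)
qed

definition nrm :: "'a \<Rightarrow> 'a" where "nrm v = - (1 / norm (g v)) *\<^sub>R g v"

text \<open>Green's formula for an affine function. The weighted normal \<open>area * nrm v\<close> is \<open>- d vol * g v\<close>, and
\<open>d\<close> times the facet mean is the sum \<open>S\<close> of all vertex values minus the value in \<open>v\<close>. As the \<open>g v\<close> add up to
zero, only the vertex values remain, and these recover the gradient.\<close>

lemma gradient_from_facets:
  fixes a :: 'a
  shows "(\<Sum>v\<in>C. (area (convex hull (C - {v})) * (a \<bullet> centroid (convex hull (C - {v})) + c)) *\<^sub>R nrm v)
       = measure lborel (convex hull C) *\<^sub>R a"
proof -
  let ?V = "measure lborel (convex hull C)"
  define S where "S = (\<Sum>w\<in>C. a \<bullet> w + c)"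
  have cen: "DIM('a) * (a \<bullet> centroid (convex hull (C - {v})) + c) = S - (a \<bullet> v + c)" if v: "v \<in> C" for v
  proof -
    let ?z = "centroid (convex hull (C - {v}))"
    have "a \<bullet> ?z + c = (\<Sum>w\<in>C. lam w ?z * (a \<bullet> w + c))" by (rule affine_expand)
    also have "\<dots> = (\<Sum>w\<in>C - {v}. lam w ?z * (a \<bullet> w + c))"
      using lam_centroid[OF v v] by (simp add: sum.remove[OF finC v])
    also have "\<dots> = (\<Sum>w\<in>C - {v}. (a \<bullet> w + c) / DIM('a))"
      by (intro sum.cong) (auto simp: lam_centroid[OF v])
    also have "\<dots> = (S - (a \<bullet> v + c)) / DIM('a)"
      by (simp add: S_def sum.remove[OF finC v] sum_divide_distrib)
    finally show ?thesis by simp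
  qed
  have "(\<Sum>v\<in>C. (area (convex hull (C - {v})) * (a \<bullet> centroid (convex hull (C - {v})) + c)) *\<^sub>R nrm v)
      = (\<Sum>v\<in>C. - (?V * (S - (a \<bullet> v + c))) *\<^sub>R g v)"
  proof (intro sum.cong refl)
    fix v assume v: "v \<in> C"
    show "(area (convex hull (C - {v})) * (a \<bullet> centroid (convex hull (C - {v})) + c)) *\<^sub>R nrm v
        = - (?V * (S - (a \<bullet> v + c))) *\<^sub>R g v"
      using g_nonzero[OF v] by (simp add: nrm_def area_volume(1)[OF v] cen[OF v, symmetric])
  qed
  also have "\<dots> = ?V *\<^sub>R ((\<Sum>v\<in>C. (a \<bullet> v + c) *\<^sub>R g v) - S *\<^sub>R (\<Sum>v\<in>C. g v))"
    by (simp add: scaleR_sum_right scaleR_diff_right sum_subtractf[symmetric] algebra_simps)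
  also have "\<dots> = ?V *\<^sub>R a" by (simp add: gradient_from_vertices sum_g)
  finally show ?thesis .
qed

text \<open>The functions \<open>1 - d * lam w\<close> are the Crouzeix--Raviart basis: their facet means are one on the
facet opposite to \<open>w\<close> and zero on the others.\<close>

lemma facet_means_interpolation:
  obtains a c where "\<And>v. v \<in> C \<Longrightarrow> a \<bullet> centroid (convex hull (C - {v})) + c = m v"
proof
  fix v assume v: "v \<in> C"
  let ?z = "centroid (convex hull (C - {v}))" and ?d = "real DIM('a)"
  have "(- (\<Sum>w\<in>C. (?d * m w) *\<^sub>R g w)) \<bullet> ?z + (\<Sum>w\<in>C. m w * (1 - ?d * b w)) = (\<Sum>w\<in>C. m w * (1 - ?d * lam w ?z))"
    by (simp add: lam_def inner_sum_left sum_subtractf[symmetric] sum_negf[symmetric] sum.distrib[symmetric] algebra_simps)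
  also have "\<dots> = (\<Sum>w\<in>C. if w = v then m w else 0)"
    by (intro sum.cong) (auto simp: lam_centroid[OF v])
  also have "\<dots> = m v" using v by simp
  finally show "(- (\<Sum>w\<in>C. (?d * m w) *\<^sub>R g w)) \<bullet> ?z + (\<Sum>w\<in>C. m w * (1 - ?d * b w)) = m v" .
qed

text \<open>If an affine function is constant on a facet, only the opposite vertex contributes to its gradient, which
is therefore a multiple of \<open>g v\<close>; the norm and the side of the simplex fix the multiple.\<close>

lemma outer_normal_face:
  assumes v: "v \<in> C"
  shows "outer_normal (convex hull C) (convex hull (C - {v})) = nrm v"
    and "norm n = 1 \<Longrightarrow> convex hull (C - {v}) \<subseteq> {x. n \<bullet> x = c} \<Longrightarrow> convex hull C \<subseteq> {x. n \<bullet> x \<le> c}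
         \<Longrightarrow> n = nrm v"
proof -
  have gv: "norm (g v) > 0" using g_nonzero[OF v] by simp
  show uniq: "n = nrm v" if n: "norm n = 1" and e: "convex hull (C - {v}) \<subseteq> {x. n \<bullet> x = c}"
    and K: "convex hull C \<subseteq> {x. n \<bullet> x \<le> c}" for n c
  proof -
    have 0: "n \<bullet> w + (-c) = 0" if "w \<in> C - {v}" for w
      using e hull_inc[OF that, of convex] by auto
    have "n = (\<Sum>w\<in>C. (n \<bullet> w + (-c)) *\<^sub>R g w)" by (rule gradient_from_vertices[symmetric])
    also have "\<dots> = (n \<bullet> v - c) *\<^sub>R g v"
      using 0 by (simp add: sum.remove[OF finC v])
    finally have neq: "n = (n \<bullet> v - c) *\<^sub>R g v" .
    have le: "n \<bullet> v - c \<le> 0" using K hull_inc[OF v, of convex] by auto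
    have "1 = \<bar>n \<bullet> v - c\<bar> * norm (g v)" using n by (subst (asm) neq) simp
    with le gv have "n \<bullet> v - c = - (1 / norm (g v))" by (simp add: field_simps)
    with neq show ?thesis by (simp add: nrm_def)
  qed
  have "norm (nrm v) = 1" using gv by (simp add: nrm_def)
  moreover have "convex hull (C - {v}) \<subseteq> {x. nrm v \<bullet> x = b v / norm (g v)}"
    using gv by (auto simp: face_eq[OF v] nrm_def lam_def field_simps)
  moreover have "convex hull C \<subseteq> {x. nrm v \<bullet> x \<le> b v / norm (g v)}"
    using gv v by (auto simp: hull_eq nrm_def lam_def field_simps)
  ultimately show "outer_normal (convex hull C) (convex hull (C - {v})) = nrm v"
    unfolding outer_normal_def by (intro the_equality) (use uniq in blast)+
qed

end

lemma bary_simplex_exists: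
  fixes C :: "'a::euclidean_space set"
  assumes ind: "\<not> affine_dependent C" and card: "card C = Suc DIM('a)"
  obtains g b where "bary_simplex C g b"
proof -
  have fin: "finite C" using ind by (rule aff_independent_finite)
  have "aff_dim C = DIM('a)" using ind card by (simp add: affine_independent_iff_card)
  then have span: "affine hull C = UNIV" by (simp add: affine_hull_UNIV)
  have "\<exists>g c. \<forall>w\<in>C. g \<bullet> w + c = (if v = w then 1 else 0)" if v: "v \<in> C" for v
  proof -
    have "aff_dim (C - {v}) = DIM('a) - 1"
      using affine_independent_Diff[OF ind, of "{v}"] card v fin by (simp add: affine_independent_iff_card)
    then obtain a d where a: "a \<noteq> 0" "affine hull (C - {v}) = {x. a \<bullet> x = d}"
      using aff_dim_eq_hyperplane[of "C - {v}"] by auto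
    have nv: "a \<bullet> v \<noteq> d" using ind v a(2) by (auto simp: affine_dependent_def)
    have "a \<bullet> w = d" if "w \<in> C" "w \<noteq> v" for w
      using a(2) hull_inc[of w "C - {v}" affine] that by auto
    moreover have "((1 / (a \<bullet> v - d)) *\<^sub>R a) \<bullet> w + (- d / (a \<bullet> v - d)) = (a \<bullet> w - d) / (a \<bullet> v - d)" for w
      by (simp add: diff_divide_distrib)
    ultimately have "\<forall>w\<in>C. ((1 / (a \<bullet> v - d)) *\<^sub>R a) \<bullet> w + (- d / (a \<bullet> v - d)) = (if v = w then 1 else 0)"
      using nv by (simp add: eq_commute[of v])
    then show ?thesis by blast
  qed
  then obtain g b where "\<And>v. v \<in> C \<Longrightarrow> \<forall>w\<in>C. g v \<bullet> w + b v = (if v = w then 1 else 0)"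
    by metis
  then have "bary_simplex C g b"
    using fin card span by unfold_locales auto
  then show ?thesis by (rule that)
qed

section \<open>Facets of a cell\<close>

abbreviation cell :: "'a::euclidean_space set \<Rightarrow> bool" where
  "cell K \<equiv> int DIM('a) simplex K"

abbreviation vol :: "'a::euclidean_space set \<Rightarrow> real" where
  "vol K \<equiv> measure lborel K"

lemma cell_bary:
  fixes K :: "'a::euclidean_space set"
  assumes "cell K"
  obtains C g b where "bary_simplex C g b" "K = convex hull C"
    "facets K = (\<lambda>v. convex hull (C - {v})) ` C" "inj_on (\<lambda>v. convex hull (C - {v})) C"
proof -
  from assms obtain C where C: "\<not> affine_dependent C" "int (card C) = int DIM('a) + 1" "K = convex hull C"
    by (auto simp: simplex_def)
  then have card: "card C = Suc DIM('a)" by simp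
  obtain g b where bs: "bary_simplex C g b" using bary_simplex_exists[OF C(1) card] .
  interpret bary_simplex C g b by (rule bs)
  have "facets K = (\<lambda>v. convex hull (C - {v})) ` C"
    using hull_face_nonempty by (auto simp: facets_def C(3) facet_of_convex_hull_affine_independent[OF C(1)])
  moreover have "inj_on (\<lambda>v. convex hull (C - {v})) C"
  proof (rule inj_onI, rule ccontr)
    fix v w assume vw: "v \<in> C" "w \<in> C" "convex hull (C - {v}) = convex hull (C - {w})" "v \<noteq> w"
    then have "w \<in> convex hull (C - {w})" using hull_inc[of w "C - {v}" convex] by auto
    then show False using face_eq[OF vw(2)] lam_vertex[OF vw(2,2)] by simp
  qed
  ultimately show ?thesis using that bs C(3) by blast
qed

lemma finite_facets: "cell K \<Longrightarrow> finite (facets K)"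
  by (erule cell_bary) (simp add: bary_simplex.finC)

lemma facet_compact_nonempty:
  assumes "cell K" "e \<in> facets K"
  shows "compact e" "e \<noteq> {}"
proof -
  obtain C g b where C: "bary_simplex C g b" "facets K = (\<lambda>v. convex hull (C - {v})) ` C"
    by (rule cell_bary[OF assms(1)])
  interpret bary_simplex C g b by (rule C(1))
  show "compact e" "e \<noteq> {}"
    using assms(2) compact_face face_nonempty by (auto simp: C(2))
qed

lemma facet_area_pos:
  assumes "cell K" "e \<in> facets K"
  shows "area e > 0"
proof -
  obtain C g b where C: "bary_simplex C g b" "facets K = (\<lambda>v. convex hull (C - {v})) ` C"
    by (rule cell_bary[OF assms(1)])
  interpret bary_simplex C g b by (rule C(1))
  show ?thesis using assms(2) area_pos by (auto simp: C(2))
qed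

lemma cell_vol_pos:
  assumes "cell K" shows "vol K > 0"
proof -
  obtain C g b where C: "bary_simplex C g b" "K = convex hull C"
    by (rule cell_bary[OF assms(1)])
  interpret bary_simplex C g b by (rule C(1))
  obtain v where "v \<in> C" using cardC by fastforce
  then show ?thesis unfolding C(2) by (rule area_volume(2))
qed

text \<open>The divergence theorem on a cell, for affine fields of constant direction. Both Green's formula and
the unisolvence of the facet means follow from it.\<close>

lemma divergence_identity:
  fixes K :: "'a::euclidean_space set"
  assumes "cell K"
  shows "(\<Sum>e\<in>facets K. (area e * (a \<bullet> centroid e + c)) *\<^sub>R outer_normal K e) = vol K *\<^sub>R a"
proof -
  obtain C g b where C: "bary_simplex C g b" "K = convex hull C" "facets K = (\<lambda>v. convex hull (C - {v})) ` C"
     "inj_on (\<lambda>v. convex hull (C - {v})) C"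
    by (rule cell_bary[OF assms(1)])
  interpret bary_simplex C g b by (rule C(1))
  have "(\<Sum>e\<in>facets K. (area e * (a \<bullet> centroid e + c)) *\<^sub>R outer_normal K e)
     = (\<Sum>v\<in>C. (area (convex hull (C - {v})) * (a \<bullet> centroid (convex hull (C - {v})) + c)) *\<^sub>R nrm v)"
    unfolding C(3) by (simp add: sum.reindex[OF C(4)] C(2) outer_normal_face(1))
  then show ?thesis by (simp add: gradient_from_facets C(2))
qed

lemma cell_interpolation:
  fixes K :: "'a::euclidean_space set"
  assumes "cell K"
  obtains a c where "\<And>e. e \<in> facets K \<Longrightarrow> a \<bullet> centroid e + c = m e"
proof -
  obtain C g b where C: "bary_simplex C g b" "facets K = (\<lambda>v. convex hull (C - {v})) ` C"
    by (rule cell_bary[OF assms(1)])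
  interpret bary_simplex C g b by (rule C(1))
  obtain a c where "\<And>v. v \<in> C \<Longrightarrow> a \<bullet> centroid (convex hull (C - {v})) + c = m (convex hull (C - {v}))"
    by (rule facet_means_interpolation[of "\<lambda>v. m (convex hull (C - {v}))"]) blast
  then have "\<And>e. e \<in> facets K \<Longrightarrow> a \<bullet> centroid e + c = m e" by (auto simp: C(2))
  then show ?thesis by (rule that)
qed

lemma outer_normal_works:
  assumes "cell K" "e \<in> facets K"
  shows "norm (outer_normal K e) = 1"
    and "\<exists>c. e \<subseteq> {x. outer_normal K e \<bullet> x = c} \<and> K \<subseteq> {x. outer_normal K e \<bullet> x \<le> c}"
proof -
  obtain C g b where C: "bary_simplex C g b" "K = convex hull C" "facets K = (\<lambda>v. convex hull (C - {v})) ` C"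
    by (rule cell_bary[OF assms(1)])
  interpret bary_simplex C g b by (rule C(1))
  obtain v where v: "v \<in> C" "e = convex hull (C - {v})" using assms(2) C(3) by auto
  have n: "outer_normal K e = nrm v" by (simp add: C(2) v outer_normal_face(1))
  have gv: "norm (g v) > 0" using g_nonzero[OF v(1)] by simp
  show "norm (outer_normal K e) = 1" using gv by (simp add: n nrm_def)
  have "e \<subseteq> {x. nrm v \<bullet> x = b v / norm (g v)}" "K \<subseteq> {x. nrm v \<bullet> x \<le> b v / norm (g v)}"
    using gv v(1) by (auto simp: face_eq[OF v(1)] v(2) C(2) hull_eq nrm_def lam_def field_simps)
  then show "\<exists>c. e \<subseteq> {x. outer_normal K e \<bullet> x = c} \<and> K \<subseteq> {x. outer_normal K e \<bullet> x \<le> c}"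
    unfolding n by blast
qed

lemma outer_normal_unique:
  assumes "cell K" "e \<in> facets K"
    and "norm n = 1" "e \<subseteq> {x. n \<bullet> x = c}" "K \<subseteq> {x. n \<bullet> x \<le> c}"
  shows "n = outer_normal K e"
proof -
  obtain C g b where C: "bary_simplex C g b" "K = convex hull C" "facets K = (\<lambda>v. convex hull (C - {v})) ` C"
    by (rule cell_bary[OF assms(1)])
  interpret bary_simplex C g b by (rule C(1))
  obtain v where v: "v \<in> C" "e = convex hull (C - {v})" using assms(2) C(3) by auto
  show ?thesis
    using outer_normal_face(2)[OF v(1) assms(3)] assms(4,5) unfolding v(2) C(2) outer_normal_face(1)[OF v(1)] by blast
qed

lemma facet_normal_up_to_sign:
  assumes "cell K" "e \<in> facets K" and n: "norm n = 1" "e \<subseteq> {x. n \<bullet> x = c}"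
  shows "n = outer_normal K e \<or> n = - outer_normal K e"
proof -
  obtain C g b where C: "bary_simplex C g b" "K = convex hull C" "facets K = (\<lambda>v. convex hull (C - {v})) ` C"
    by (rule cell_bary[OF assms(1)])
  interpret bary_simplex C g b by (rule C(1))
  obtain v where v: "v \<in> C" "e = convex hull (C - {v})" using assms(2) C(3) by auto
  have "n \<bullet> w + (-c) = 0" if "w \<in> C - {v}" for w
    using n(2) v(2) hull_inc[OF that, of convex] by auto
  moreover have "n = (\<Sum>w\<in>C. (n \<bullet> w + (-c)) *\<^sub>R g w)" by (rule gradient_from_vertices[symmetric])
  ultimately have neq: "n = (n \<bullet> v - c) *\<^sub>R g v"
    by (simp add: sum.remove[OF finC v(1)])
  have gv: "norm (g v) > 0" using g_nonzero[OF v(1)] by simp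
  have "1 = \<bar>n \<bullet> v - c\<bar> * norm (g v)" using n(1) by (subst (asm) neq) simp
  with gv have "\<bar>n \<bullet> v - c\<bar> = 1 / norm (g v)" by (simp add: field_simps)
  then have "n \<bullet> v - c = 1 / norm (g v) \<or> n \<bullet> v - c = - (1 / norm (g v))" by linarith
  with neq have "n = - nrm v \<or> n = nrm v" by (auto simp: nrm_def)
  then show ?thesis using v by (auto simp: C(2) outer_normal_face(1))
qed

lemma centroid_in_facet:
  assumes "cell K" "e \<in> facets K"
  shows "centroid e \<in> e"
proof -
  obtain C g b where C: "bary_simplex C g b" "facets K = (\<lambda>v. convex hull (C - {v})) ` C"
    by (rule cell_bary[OF assms(1)])
  interpret bary_simplex C g b by (rule C(1))
  show ?thesis using assms(2) lam_centroid by (auto simp: C(2) face_eq)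
qed

text \<open>The centroid is a convex combination of the vertices of the facet with positive weights, so a linear
functional that attains its maximum there is constant.\<close>

lemma constant_if_max_at_centroid:
  assumes "cell K" "e \<in> facets K" and le: "\<And>y. y \<in> e \<Longrightarrow> n \<bullet> y \<le> n \<bullet> centroid e"
  shows "e \<subseteq> {y. n \<bullet> y = n \<bullet> centroid e}"
proof -
  obtain C g b where C: "bary_simplex C g b" "facets K = (\<lambda>v. convex hull (C - {v})) ` C"
    by (rule cell_bary[OF assms(1)])
  interpret bary_simplex C g b by (rule C(1))
  obtain v where v: "v \<in> C" "e = convex hull (C - {v})" using assms(2) C(2) by auto
  let ?z = "centroid e"
  have "0 = (\<Sum>w\<in>C. lam w ?z * (n \<bullet> w + (- (n \<bullet> ?z))))"
    by (subst affine_expand[symmetric]) simp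
  also have "\<dots> = (\<Sum>w\<in>C - {v}. lam w ?z * (n \<bullet> w - n \<bullet> ?z))"
    using lam_centroid[OF v(1,1)] by (simp add: sum.remove[OF finC v(1)] v(2))
  also have "\<dots> = (\<Sum>w\<in>C - {v}. (n \<bullet> w - n \<bullet> ?z) / DIM('a))"
    using lam_centroid[OF v(1)] by (intro sum.cong) (auto simp: v(2))
  also have "\<dots> = - (\<Sum>w\<in>C - {v}. n \<bullet> ?z - n \<bullet> w) / DIM('a)"
    by (simp add: sum_divide_distrib[symmetric] sum_negf[symmetric])
  finally have "(\<Sum>w\<in>C - {v}. n \<bullet> ?z - n \<bullet> w) = 0" by simp
  moreover have le': "0 \<le> n \<bullet> ?z - n \<bullet> w" if "w \<in> C - {v}" for w
    using le[of w] hull_inc[OF that, of convex] v(2) by simp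
  ultimately have "n \<bullet> w = n \<bullet> ?z" if "w \<in> C - {v}" for w
    using that sum_nonneg_eq_0_iff[of "C - {v}" "\<lambda>w. n \<bullet> ?z - n \<bullet> w"] by auto
  then have "convex hull (C - {v}) \<subseteq> {y. n \<bullet> y = n \<bullet> ?z}"
    by (intro hull_minimal) (auto simp: convex_hyperplane)
  then show ?thesis by (simp add: v(2))
qed

text \<open>The path starts in a point that depends on the facet only, so two cells on the same side of a common facet
are entered along the same path.\<close>

lemma interior_below_centroid:
  assumes "cell K" "e \<in> facets K"
  shows "eventually (\<lambda>t. centroid e - t *\<^sub>R outer_normal K e \<in> interior K) (at_right 0)"
proof -
  obtain C g b where C: "bary_simplex C g b" "K = convex hull C" "facets K = (\<lambda>v. convex hull (C - {v})) ` C"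
    by (rule cell_bary[OF assms(1)])
  interpret bary_simplex C g b by (rule C(1))
  obtain v where v: "v \<in> C" "e = convex hull (C - {v})" using assms(2) C(3) by auto
  let ?z = "centroid e"
  have gv: "norm (g v) > 0" using g_nonzero[OF v(1)] by simp
  have n: "outer_normal K e = nrm v" by (simp add: C(2) v outer_normal_face(1))
  have "open {x. \<forall>w\<in>C. 0 < lam w x}"
  proof -
    have "{x. \<forall>w\<in>C. 0 < lam w x} = (\<Inter>w\<in>C. {x. 0 < lam w x})" by auto
    also have "open \<dots>" unfolding lam_def
      by (intro open_INT finC ballI open_Collect_less continuous_intros)
    finally show ?thesis .
  qed
  then have int: "{x. \<forall>w\<in>C. 0 < lam w x} \<subseteq> interior K"
    by (intro interior_maximal) (auto simp: C(2) hull_eq less_imp_le)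
  have pos: "eventually (\<lambda>t. 0 < lam w (?z - t *\<^sub>R nrm v)) (at_right 0)" if w: "w \<in> C" for w
  proof (cases "w = v")
    case True
    have "lam v (?z - t *\<^sub>R nrm v) = t * norm (g v)" for t
      using lam_centroid[OF v(1,1)] gv
      by (simp add: lam_def nrm_def inner_add_right v(2) dot_square_norm power2_eq_square)
    then show ?thesis using gv True by (auto simp: eventually_at_right_less eventually_at_topological intro!: exI[of _ UNIV])
  next
    case False
    have "((\<lambda>t. lam w (?z - t *\<^sub>R nrm v)) \<longlongrightarrow> lam w (?z - 0 *\<^sub>R nrm v)) (at_right 0)"
      unfolding lam_def by (intro tendsto_intros)
    moreover have "lam w (?z - 0 *\<^sub>R nrm v) > 0"
      using False lam_centroid[OF v(1) w] by (simp add: v(2))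
    ultimately show ?thesis by (rule order_tendstoD(1))
  qed
  have "eventually (\<lambda>t. \<forall>w\<in>C. 0 < lam w (?z - t *\<^sub>R nrm v)) (at_right 0)"
    using pos by (simp add: eventually_ball_finite_distrib)
  then show ?thesis
    by (rule eventually_mono) (use int n in auto)
qed

lemma cell_interior_nonempty:
  assumes "cell K" shows "interior K \<noteq> {}"
proof -
  obtain C g b where C: "bary_simplex C g b" "facets K = (\<lambda>v. convex hull (C - {v})) ` C"
    by (rule cell_bary[OF assms(1)])
  interpret bary_simplex C g b by (rule C(1))
  obtain v where "v \<in> C" using cardC by fastforce
  then have "convex hull (C - {v}) \<in> facets K" by (auto simp: C(2))
  from eventually_happens[OF interior_below_centroid[OF assms this]] show ?thesis
    by (auto simp: trivial_limit_at_right_real)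
qed

section \<open>Facets of a simplicial mesh\<close>

lemma mesh_cell: "simplicial_mesh \<Omega> T \<Longrightarrow> K \<in> T \<Longrightarrow> cell K"
  and mesh_finite: "simplicial_mesh \<Omega> T \<Longrightarrow> finite T"
  and mesh_face: "simplicial_mesh \<Omega> T \<Longrightarrow> K \<in> T \<Longrightarrow> K' \<in> T \<Longrightarrow> K \<inter> K' face_of K"
  and mesh_Union: "simplicial_mesh \<Omega> T \<Longrightarrow> \<Union>T = closure \<Omega>"
  unfolding simplicial_mesh_def triangulation_def by blast+

lemma mesh_finite_cells: "simplicial_mesh \<Omega> T \<Longrightarrow> K \<in> T \<Longrightarrow> finite (facets K)"
  by (intro finite_facets mesh_cell)

text \<open>Two cells on the same side of a common facet have a common interior point, whereas distinct cells
meet only in proper faces.\<close>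

lemma equal_cells_if_equal_normals:
  assumes T: "simplicial_mesh \<Omega> T" and K: "K \<in> T" "K' \<in> T"
    and e: "e \<in> facets K" "e \<in> facets K'" and n: "outer_normal K e = outer_normal K' e"
  shows "K = K'"
proof -
  have "eventually (\<lambda>t. centroid e - t *\<^sub>R outer_normal K e \<in> interior K \<inter> interior K') (at_right 0)"
    using interior_below_centroid[OF mesh_cell[OF T K(1)] e(1)]
      interior_below_centroid[OF mesh_cell[OF T K(2)] e(2)]
    by (simp add: n eventually_conj_iff)
  then obtain x where x: "x \<in> interior K" "x \<in> interior K'"
    using eventually_happens by (force simp: trivial_limit_at_right_real)
  then have "x \<in> K" "x \<in> K'" using interior_subset by auto
  then have "K \<inter> K' = K" using face_of_disjoint_interior[OF mesh_face[OF T K]] x by auto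
  moreover have "K' \<inter> K = K'"
    using face_of_disjoint_interior[OF mesh_face[OF T K(2,1)]] x \<open>x \<in> K\<close> \<open>x \<in> K'\<close> by auto
  ultimately show ?thesis by auto
qed

lemma opposite_normals:
  assumes T: "simplicial_mesh \<Omega> T" and K: "K \<in> T" "K' \<in> T" "K \<noteq> K'"
    and e: "e \<in> facets K" "e \<in> facets K'"
  shows "outer_normal K' e = - outer_normal K e"
  using outer_normal_works[OF mesh_cell[OF T K(2)] e(2)]
    facet_normal_up_to_sign[OF mesh_cell[OF T K(1)] e(1)]
    equal_cells_if_equal_normals[OF T K(1,2) e] K(3) by metis

lemma at_most_two_cells:
  assumes T: "simplicial_mesh \<Omega> T" and K: "K \<in> T" "K' \<in> T" "K \<noteq> K'"
    and e: "e \<in> facets K" "e \<in> facets K'"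
  shows "{L \<in> T. e \<in> facets L} = {K, K'}"
proof -
  have "L = K \<or> L = K'" if L: "L \<in> T" "e \<in> facets L" for L
  proof (rule ccontr)
    assume "\<not> (L = K \<or> L = K')"
    then have "outer_normal L e = - outer_normal K e" "outer_normal K' e = - outer_normal K e"
      using opposite_normals[OF T K(1) L(1)] opposite_normals[OF T K(1,2)] K(3) L(2) e by auto
    then have "L = K'" using equal_cells_if_equal_normals[OF T L(1) K(2) L(2) e(2)] by simp
    then show False using \<open>\<not> (L = K \<or> L = K')\<close> by simp
  qed
  then show ?thesis using K e by auto
qed

text \<open>A hyperplane that supports the convex domain in the centroid of the facet contains the whole facet,
so that both cells lie on the same side of it.\<close>

lemma shared_facet_not_in_frontier:
  fixes \<Omega> :: "'a::euclidean_space set"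
  assumes \<Omega>: "open \<Omega>" "convex \<Omega>" and T: "simplicial_mesh \<Omega> T"
    and K: "K \<in> T" "K' \<in> T" "K \<noteq> K'" and e: "e \<in> facets K" "e \<in> facets K'"
  shows "\<not> e \<subseteq> frontier \<Omega>"
proof
  assume fr: "e \<subseteq> frontier \<Omega>"
  let ?z = "centroid e"
  have "?z \<in> frontier \<Omega>" using centroid_in_facet[OF mesh_cell[OF T K(1)] e(1)] fr by auto
  then have z: "?z \<in> closure \<Omega>" "?z \<notin> rel_interior (closure \<Omega>)"
    using \<Omega> by (auto simp: frontier_def interior_open convex_rel_interior_closure rel_interior_open)
  obtain a where a: "a \<noteq> 0" "\<And>y. y \<in> closure \<Omega> \<Longrightarrow> a \<bullet> ?z \<le> a \<bullet> y"
    by (rule supporting_hyperplane_rel_boundary[OF convex_closure[OF \<Omega>(2)] z]) (rule that)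
  define n where "n = - (1 / norm a) *\<^sub>R a"
  have n: "norm n = 1" using a(1) by (simp add: n_def)
  have le: "n \<bullet> y \<le> n \<bullet> ?z" if "y \<in> closure \<Omega>" for y
    using a(2)[OF that] a(1) by (simp add: n_def divide_right_mono)
  have sub: "L \<subseteq> closure \<Omega>" if "L \<in> T" for L using mesh_Union[OF T] that by auto
  have eK: "e \<subseteq> K" using e(1) by (simp add: facets_def facet_of_imp_subset)
  have "e \<subseteq> {y. n \<bullet> y = n \<bullet> ?z}"
    using le sub[OF K(1)] eK by (intro constant_if_max_at_centroid[OF mesh_cell[OF T K(1)] e(1)]) auto
  then have "n = outer_normal L e" if "L \<in> T" "e \<in> facets L" for L
    using le sub[OF that(1)] n by (intro outer_normal_unique[OF mesh_cell[OF T that(1)] that(2)]) auto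
  then show False using equal_cells_if_equal_normals[OF T K(1,2) e] K e by metis
qed

lemma shared_facet_or_low_dim:
  fixes T :: "'a::euclidean_space set set"
  assumes T: "simplicial_mesh \<Omega> T" and K: "K \<in> T" "K' \<in> T" "K \<noteq> K'"
    and low: "\<not> aff_dim (K \<inter> K') + 1 < int DIM('a)"
  shows "K \<inter> K' \<in> facets K" "K \<inter> K' \<in> facets K'"
proof -
  have d: "aff_dim K = int DIM('a)" "aff_dim K' = int DIM('a)"
    using aff_dim_simplex mesh_cell[OF T] K by blast+
  have f: "K \<inter> K' face_of K" "K \<inter> K' face_of K'"
    using mesh_face[OF T K(1,2)] mesh_face[OF T K(2,1)] by (auto simp: Int_commute)
  have cv: "convex K" "convex K'" using mesh_cell[OF T] K convex_simplex by blast+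
  have "K \<inter> K' \<noteq> K"
  proof
    assume "K \<inter> K' = K"
    then have "K face_of K'" using f(2) by simp
    from face_of_aff_dim_lt[OF cv(2) this K(3)] d show False by simp
  qed
  then have "aff_dim (K \<inter> K') < int DIM('a)" using face_of_aff_dim_lt[OF cv(1) f(1)] d by simp
  with low have dim: "aff_dim (K \<inter> K') = int DIM('a) - 1" by simp
  then have ne: "K \<inter> K' \<noteq> {}" using DIM_positive[where 'a='a] by auto
  show "K \<inter> K' \<in> facets K" "K \<inter> K' \<in> facets K'"
    using f dim d ne by (auto simp: facets_def facet_of_def)
qed

lemma negligible_low_aff_dim:
  fixes S :: "'a::euclidean_space set"
  assumes "aff_dim S < int DIM('a)"
  shows "negligible (affine hull S)"
proof -
  obtain a b where "a \<noteq> 0" "affine hull S \<subseteq> {x. a \<bullet> x = b}"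
    using aff_lowdim_subset_hyperplane[of "affine hull S"] assms by auto
  then show ?thesis using negligible_hyperplane negligible_subset by blast
qed

lemma negligible_affine_cone:
  fixes F :: "'a::euclidean_space set"
  assumes "aff_dim F + 1 < int DIM('a)"
  shows "negligible (affine hull (insert x F))"
  using assms by (intro negligible_low_aff_dim) (auto simp: aff_dim_insert)

text \<open>Any two cells are linked by a chain of cells with common facets. Otherwise the cells split into two
classes that meet only in faces of dimension at most \<open>d - 2\<close>. A generic segment between interior points of cells of
different classes avoids these faces, as the cones over them are null sets; then the two classes split
the segment into disjoint closed sets, although it is connected.\<close>

lemma mesh_facet_connected:
  fixes \<Omega> :: "'a::euclidean_space set"
  assumes \<Omega>: "convex \<Omega>" and T: "simplicial_mesh \<Omega> T"
    and S: "S \<subseteq> T" "S \<noteq> {}"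
    and step: "\<And>K K'. K \<in> S \<Longrightarrow> K' \<in> T \<Longrightarrow> facets K \<inter> facets K' \<noteq> {} \<Longrightarrow> K' \<in> S"
  shows "S = T"
proof (rule ccontr)
  assume "S \<noteq> T"
  then obtain K' where K': "K' \<in> T" "K' \<notin> S" using S by auto
  obtain K where K: "K \<in> S" using S by auto
  have fin: "finite T" by (rule mesh_finite[OF T])
  define low where "low = (\<lambda>(L, L'). L \<inter> L') ` (S \<times> (T - S))"
  have finlow: "finite low" using fin S(1) by (auto simp: low_def intro: finite_subset)
  have dim: "aff_dim F + 1 < int DIM('a)" if "F \<in> low" for F
  proof (rule ccontr)
    assume *: "\<not> aff_dim F + 1 < int DIM('a)"
    from that obtain L L' where L: "L \<in> S" "L' \<in> T" "L' \<notin> S" "F = L \<inter> L'" by (auto simp: low_def)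
    then have "L \<noteq> L'" "L \<in> T" using S by auto
    from shared_facet_or_low_dim[OF T this(2) L(2) this(1)] * L(4)
    have "facets L \<inter> facets L' \<noteq> {}" by auto
    then show False using step[OF L(1,2)] L(3) by simp
  qed
  have "\<not> negligible (interior K)"
    using K S by (intro open_not_negligible cell_interior_nonempty mesh_cell[OF T]) auto
  moreover have "negligible (\<Union>F\<in>low. affine hull F)"
    using finlow dim by (intro negligible_Union) (fastforce intro: negligible_low_aff_dim)+
  ultimately obtain x where x: "x \<in> interior K" "\<And>F. F \<in> low \<Longrightarrow> x \<notin> affine hull F"
    using negligible_subset[of "\<Union>F\<in>low. affine hull F" "interior K"] by blast
  have "\<not> negligible (interior K')"
    using K' by (intro open_not_negligible cell_interior_nonempty mesh_cell[OF T]) auto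
  moreover have "negligible (\<Union>F\<in>low. affine hull (insert x F))"
    using finlow dim by (intro negligible_Union) (auto intro: negligible_affine_cone)
  ultimately obtain y where y: "y \<in> interior K'" "\<And>F. F \<in> low \<Longrightarrow> y \<notin> affine hull (insert x F)"
    using negligible_subset[of "\<Union>F\<in>low. affine hull (insert x F)" "interior K'"] by blast
  have xy: "x \<in> K" "y \<in> K'" using x y interior_subset by auto
  have cl: "closed L" if "L \<in> T" for L using closed_simplex mesh_cell[OF T that] by blast
  have "closed_segment x y \<subseteq> closure \<Omega>"
    using xy K S K' mesh_Union[OF T] by (intro closed_segment_subset convex_closure \<Omega>) auto
  moreover have "\<Union>T \<subseteq> \<Union>S \<union> \<Union>(T - S)" by fast
  ultimately have cover: "closed_segment x y \<subseteq> \<Union>S \<union> \<Union>(T - S)"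
    unfolding mesh_Union[OF T] by (rule order_trans)
  have disj: "\<Union>S \<inter> \<Union>(T - S) \<inter> closed_segment x y = {}"
  proof (rule ccontr)
    assume "\<Union>S \<inter> \<Union>(T - S) \<inter> closed_segment x y \<noteq> {}"
    then obtain z L L' where z: "z \<in> closed_segment x y" "L \<in> S" "L' \<in> T" "L' \<notin> S" "z \<in> L \<inter> L'" by blast
    then have F: "L \<inter> L' \<in> low" by (force simp: low_def)
    obtain t where t: "z = (1 - t) *\<^sub>R x + t *\<^sub>R y" using z(1) by (auto simp: closed_segment_def)
    have zF: "z \<in> affine hull (L \<inter> L')" using z(5) by (rule hull_inc)
    have "t \<noteq> 0" using t x(2)[OF F] zF by auto
    then have yeq: "y = (1 - 1/t) *\<^sub>R x + (1/t) *\<^sub>R z"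
      unfolding t by (simp add: algebra_simps)
    have "z \<in> affine hull (insert x (L \<inter> L'))" "x \<in> affine hull (insert x (L \<inter> L'))"
      using z(5) by (auto intro: hull_inc)
    then have "y \<in> affine hull (insert x (L \<inter> L'))"
      unfolding yeq using affine_affine_hull[of "insert x (L \<inter> L')"] by (auto simp: affine_def)
    then show False using y(2)[OF F] by simp
  qed
  have "closed (\<Union>S)" "closed (\<Union>(T - S))"
    using cl S fin by (auto intro!: closed_Union intro: finite_subset)
  then have "\<Union>S \<inter> closed_segment x y = {} \<or> \<Union>(T - S) \<inter> closed_segment x y = {}"
    using connected_closedD[OF _ disj cover] by simp
  then show False using xy K K' by auto
qed

text \<open>A facet \<open>F\<close> of the closed domain is covered by its intersections with the cells, which are faces of
the cells. If all of them had dimension at most \<open>d - 2\<close>, the cone over \<open>F\<close> with an apex inside the domain would be a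
null set.\<close>

lemma boundary_facet_exists:
  fixes \<Omega> :: "'a::euclidean_space set"
  assumes \<Omega>: "convex_polyhedral_domain \<Omega>" and T: "simplicial_mesh \<Omega> T"
  obtains K e where "K \<in> T" "e \<in> facets K" "e \<subseteq> frontier \<Omega>"
proof -
  let ?P = "closure \<Omega>"
  have op: "open \<Omega>" "convex \<Omega>" "\<Omega> \<noteq> {}" "bounded \<Omega>" "polytope ?P"
    using \<Omega> by (auto simp: convex_polyhedral_domain_def)
  have ri: "rel_interior ?P = \<Omega>"
    using op by (simp add: convex_rel_interior_closure rel_interior_open)
  have int: "interior ?P = \<Omega>"
    using op by (simp add: convex_interior_closure interior_open)
  have dimP: "aff_dim ?P = int DIM('a)"
    using op by (simp add: aff_dim_open)
  have "?P \<noteq> \<Omega>"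
  proof
    assume "?P = \<Omega>"
    then have "closed \<Omega>" by (metis closed_closure)
    then have "\<Omega> = UNIV" using op clopen by blast
    then show False using op(4) not_bounded_UNIV by blast
  qed
  then have "?P - rel_interior ?P \<noteq> {}" using closure_subset ri by blast
  then obtain F where F: "F facet_of ?P"
    using rel_boundary_of_polyhedron[OF polytope_imp_polyhedron[OF op(5)]] by auto
  then have Ff: "F face_of ?P" and Fne: "F \<noteq> {}" and dimF: "aff_dim F = int DIM('a) - 1"
    using dimP by (auto simp: facet_of_def)
  have FP: "F \<subseteq> ?P" using Ff by (rule face_of_imp_subset)
  have "F \<inter> interior ?P = {}"
    using dimF dimP by (intro face_of_disjoint_interior[OF Ff]) auto
  then have Ffr: "F \<subseteq> frontier \<Omega>" using FP int op(1) by (auto simp: frontier_def interior_open)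
  have cvF: "convex F" using Ff face_of_imp_convex by blast
  show ?thesis
  proof (cases "\<exists>K\<in>T. \<not> aff_dim (K \<inter> F) + 1 < int DIM('a)")
    case True
    then obtain K where K: "K \<in> T" "\<not> aff_dim (K \<inter> F) + 1 < int DIM('a)" by blast
    have "K \<subseteq> ?P" using mesh_Union[OF T] K(1) by auto
    then have "(F \<inter> K) face_of K"
      using face_of_slice[OF Ff convex_simplex[OF mesh_cell[OF T K(1)]]] by (simp add: inf.absorb2)
    moreover have dim: "aff_dim (F \<inter> K) = int DIM('a) - 1"
      using aff_dim_subset[of "F \<inter> K" F] K(2) dimF by (simp add: Int_commute)
    moreover have "F \<inter> K \<noteq> {}" using dim DIM_positive[where 'a='a] by auto
    ultimately have "F \<inter> K \<in> facets K"
      using aff_dim_simplex[OF mesh_cell[OF T K(1)]] by (simp add: facets_def facet_of_def)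
    then show ?thesis using that[OF K(1)] Ffr by auto
  next
    case False
    obtain x where x: "x \<in> \<Omega>" using op by auto
    have "x \<notin> affine hull F"
    proof
      assume "x \<in> affine hull F"
      moreover have "x \<in> ?P" using x closure_subset by auto
      ultimately have "x \<in> F"
        using face_of_imp_eq_affine_Int[OF convex_closure[OF op(2)] Ff] by blast
      then show False using Ffr x op(1) by (auto simp: frontier_def interior_open)
    qed
    then have "aff_dim (convex hull (insert x F)) = int DIM('a)"
      unfolding aff_dim_convex_hull by (simp add: aff_dim_insert dimF)
    then have "affine hull (convex hull (insert x F)) = UNIV"
      by (simp only: aff_dim_eq_full)
    then have "interior (convex hull (insert x F)) \<noteq> {}"
      using rel_interior_eq_empty[OF convex_convex_hull, of "insert x F"] by (simp add: rel_interior_interior)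
    then have "\<not> negligible (convex hull (insert x F))"
      using open_not_negligible negligible_subset interior_subset open_interior by metis
    moreover have "negligible (\<Union>K\<in>T. affine hull (insert x (K \<inter> F)))"
      using mesh_finite[OF T] False by (intro negligible_Union) (auto intro: negligible_affine_cone)
    moreover have "convex hull (insert x F) \<subseteq> (\<Union>K\<in>T. affine hull (insert x (K \<inter> F)))"
    proof
      fix y assume "y \<in> convex hull (insert x F)"
      then obtain u v c where y: "u + v = 1" "c \<in> F" "y = u *\<^sub>R x + v *\<^sub>R c"
        using Fne cvF by (auto simp: convex_hull_insert hull_same)
      obtain K where K: "K \<in> T" "c \<in> K" using y(2) FP mesh_Union[OF T] by blast
      have "x \<in> affine hull (insert x (K \<inter> F))" "c \<in> affine hull (insert x (K \<inter> F))"
        using K y(2) by (auto intro: hull_inc)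
      then have "y \<in> affine hull (insert x (K \<inter> F))"
        unfolding y(3) using affine_affine_hull[of "insert x (K \<inter> F)"] y(1) by (auto simp: affine_def)
      then show "y \<in> (\<Union>K\<in>T. affine hull (insert x (K \<inter> F)))" using K(1) by blast
    qed
    ultimately show ?thesis using negligible_subset by blast
  qed
qed

section \<open>Affine fields\<close>

text \<open>The Jacobian of an affine field is the same everywhere; fixing the point of evaluation makes it a constant
of the field.\<close>

definition jac :: "(real^'d \<Rightarrow> real^'d) \<Rightarrow> real^'d^'d" where
  "jac \<phi> = jacobian \<phi> (at 0)"

lemma P0_eq: "v \<in> P0 \<Longrightarrow> v x = v 0"
  by (auto simp: P0_def)

lemma P0_subset_P1: "P0 \<subseteq> P1"
  by (auto simp: P0_def P1_def intro!: exI[of _ "\<lambda>x. 0"] linear_zero)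

lemma P1_diff: "v \<in> P1 \<Longrightarrow> w \<in> P1 \<Longrightarrow> (\<lambda>x. v x - w x) \<in> P1"
proof -
  assume "v \<in> P1" "w \<in> P1"
  then obtain A c B d where "linear A" "v = (\<lambda>x. A x + c)" "linear B" "w = (\<lambda>x. B x + d)"
    by (auto simp: P1_def)
  then show ?thesis
    by (auto simp: P1_def intro!: exI[of _ "\<lambda>x. A x - B x"] exI[of _ "c - d"] linear_compose_sub)
qed

lemma jacobian_affine:
  fixes D :: "real^'d^'d"
  shows "jacobian (\<lambda>x. D *v x + c) (at x) = D"
    and "frechet_derivative (\<lambda>x. D *v x + c) (at x) = (*v) D"
proof -
  have "((\<lambda>x. D *v x + c) has_derivative (*v) D) (at x)"
    by (auto intro!: derivative_eq_intros bounded_linear_imp_has_derivative matrix_vector_mul_bounded_linear)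
  then show f: "frechet_derivative (\<lambda>x. D *v x + c) (at x) = (*v) D"
    by (rule frechet_derivative_at[symmetric])
  show "jacobian (\<lambda>x. D *v x + c) (at x) = D"
    unfolding jacobian_def f by (rule matrix_of_matrix_vector_mul)
qed

lemma P1_jac:
  fixes \<phi> :: "real^'d \<Rightarrow> real^'d"
  assumes "\<phi> \<in> P1"
  shows "\<phi> x = jac \<phi> *v x + \<phi> 0"
    and "jacobian \<phi> (at x) = jac \<phi>"
    and "frechet_derivative \<phi> (at x) = (*v) (jac \<phi>)"
proof -
  obtain A c where A: "linear A" "\<phi> = (\<lambda>x. A x + c)" using assms by (auto simp: P1_def)
  have eq: "\<phi> = (\<lambda>x. matrix A *v x + c)"
    using A by (simp add: matrix_works)
  show "\<phi> x = jac \<phi> *v x + \<phi> 0" "jacobian \<phi> (at x) = jac \<phi>" "frechet_derivative \<phi> (at x) = (*v) (jac \<phi>)"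
    by (simp_all add: eq jac_def jacobian_affine)
qed

lemma jac_diff:
  fixes v w :: "real^'d \<Rightarrow> real^'d"
  assumes "v \<in> P1" "w \<in> P1"
  shows "jac (\<lambda>x. v x - w x) = jac v - jac w"
proof -
  have "(\<lambda>x. v x - w x) = (\<lambda>x. (jac v - jac w) *v x + (v 0 - w 0))"
    by (rule ext) (subst P1_jac(1)[OF assms(1)], subst P1_jac(1)[OF assms(2)],
        simp add: matrix_vector_mult_diff_rdistrib)
  then show ?thesis by (simp only: jac_def jacobian_affine(1))
qed

lemma facet_integral_P1:
  fixes \<psi> :: "'a::euclidean_space \<Rightarrow> 'b::euclidean_space"
  assumes K: "cell K" "e \<in> facets K" and \<psi>: "\<psi> \<in> P1"
  shows "(LINT x|surface_measure e. \<psi> x) = area e *\<^sub>R \<psi> (centroid e)"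
    and "(LINT x|surface_measure e. z \<bullet> \<psi> x) = area e * (z \<bullet> \<psi> (centroid e))"
proof -
  note e = facet_compact_nonempty[OF K] facet_area_pos[OF K]
  obtain A c where A: "linear A" "\<psi> = (\<lambda>x. A x + c)" using \<psi> by (auto simp: P1_def)
  show "(LINT x|surface_measure e. \<psi> x) = area e *\<^sub>R \<psi> (centroid e)"
    using surface_integral_affine[OF e A(1)] by (simp add: A(2))
  have "linear (\<lambda>x. z \<bullet> A x)"
    using A(1) by (intro linearI) (auto simp: linear_add linear_scale inner_add_right)
  from surface_integral_affine[OF e this, of "z \<bullet> c"]
  show "(LINT x|surface_measure e. z \<bullet> \<psi> x) = area e * (z \<bullet> \<psi> (centroid e))"
    by (simp add: A(2) inner_add_right)
qed

text \<open>The projection of an affine function to the constants is its facet mean, i.e. its value in the centroid.\<close>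

lemma facet_proj_P1:
  fixes \<psi> :: "'a::euclidean_space \<Rightarrow> 'b::euclidean_space"
  assumes K: "cell K" "e \<in> facets K" and \<psi>: "\<psi> \<in> P1"
  shows "facet_proj e \<psi> = (\<lambda>x. \<psi> (centroid e))"
proof -
  have res: "(LINT x|surface_measure e. (\<psi> x - c) \<bullet> z) = area e * ((\<psi> (centroid e) - c) \<bullet> z)" for c z
  proof -
    have "(\<lambda>x. \<psi> x - c) \<in> P1" using \<psi> P0_subset_P1 by (intro P1_diff) (auto simp: P0_def)
    from facet_integral_P1(2)[OF K this, of z] show ?thesis by (simp add: inner_commute)
  qed
  show ?thesis
    unfolding facet_proj_def
  proof (rule the_equality)
    show "(\<lambda>x. \<psi> (centroid e)) \<in> P0 \<and>
        (\<forall>z\<in>P0. (LINT x|surface_measure e. (\<psi> x - \<psi> (centroid e)) \<bullet> z x) = 0)"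
      by (auto simp: P0_def res)
  next
    fix w assume w: "w \<in> P0 \<and> (\<forall>z\<in>P0. (LINT x|surface_measure e. (\<psi> x - w x) \<bullet> z x) = 0)"
    then obtain c where c: "w = (\<lambda>x. c)" by (auto simp: P0_def)
    have "(\<lambda>x. \<psi> (centroid e) - c) \<in> P0" by (auto simp: P0_def)
    from w[THEN conjunct2, rule_format, OF this] have "(LINT x|surface_measure e. (\<psi> x - c) \<bullet> (\<psi> (centroid e) - c)) = 0"
      unfolding c .
    then show "w = (\<lambda>x. \<psi> (centroid e))"
      using facet_area_pos[OF K] by (simp add: res c)
  qed
qed

lemma cell_integral_const:
  fixes K :: "'a::euclidean_space set"
  assumes "cell K"
  shows "(LINT x|lebesgue_on K. (r::real)) = vol K * r"
proof -
  have "K \<in> sets borel" using closed_simplex[OF assms] by (rule borel_closed)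
  then show ?thesis by (simp add: measure_restrict_space)
qed

text \<open>The divergence theorem, applied to every component of the field.\<close>

lemma green_affine:
  fixes M D :: "real^'d^'d"
  assumes K: "cell K"
  shows "(\<Sum>e\<in>facets K. area e * ((M *v outer_normal K e) \<bullet> (D *v centroid e + c))) = vol K * (M \<bullet> D)"
proof -
  have "(\<Sum>e\<in>facets K. area e * ((M *v outer_normal K e) \<bullet> (D *v centroid e + c)))
      = (\<Sum>e\<in>facets K. \<Sum>i\<in>UNIV. M $ i \<bullet> ((area e * (D $ i \<bullet> centroid e + c $ i)) *\<^sub>R outer_normal K e))"
    by (simp add: inner_vec_def[of "M *v _"] matrix_vector_mul_component sum_distrib_left ac_simps)
  also have "\<dots> = (\<Sum>i\<in>UNIV. \<Sum>e\<in>facets K. M $ i \<bullet> ((area e * (D $ i \<bullet> centroid e + c $ i)) *\<^sub>R outer_normal K e))"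
    by (rule sum.swap)
  also have "\<dots> = (\<Sum>i\<in>UNIV. M $ i \<bullet> (vol K *\<^sub>R (D $ i)))"
    by (simp only: inner_sum_right[symmetric] divergence_identity[OF K])
  also have "\<dots> = vol K * (M \<bullet> D)"
    by (simp add: inner_vec_def[of M] sum_distrib_left)
  finally show ?thesis .
qed

lemma green_P1:
  fixes \<phi> :: "real^'d \<Rightarrow> real^'d"
  assumes K: "cell K" and \<phi>: "\<phi> \<in> P1"
  shows "(\<Sum>e\<in>facets K. area e * ((M *v outer_normal K e) \<bullet> \<phi> (centroid e))) = vol K * (M \<bullet> jac \<phi>)"
  by (subst P1_jac(1)[OF \<phi>]) (rule green_affine[OF K])

lemma divergence_P1:
  fixes \<phi> :: "real^'d \<Rightarrow> real^'d"
  assumes K: "cell K" and \<phi>: "\<phi> \<in> P1"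
  shows "(\<Sum>e\<in>facets K. area e * (outer_normal K e \<bullet> \<phi> (centroid e))) = vol K * trace (jac \<phi>)"
proof -
  have "(mat 1 :: real^'d^'d) \<bullet> jac \<phi> = (\<Sum>i\<in>UNIV. \<Sum>j\<in>UNIV. if i = j then jac \<phi> $ i $ j else 0)"
    unfolding inner_vec_def by (intro sum.cong refl) (simp add: mat_def)
  also have "\<dots> = trace (jac \<phi>)" by (simp add: trace_def)
  finally show ?thesis using green_P1[OF K \<phi>, of "mat 1"] by simp
qed

lemma facets_nonempty:
  fixes K :: "'a::euclidean_space set"
  assumes "cell K" shows "facets K \<noteq> {}"
proof
  assume "facets K = {}"
  moreover obtain i :: 'a where "i \<in> Basis" using nonempty_Basis by blast
  ultimately show False
    using divergence_identity[OF assms, of i 0] cell_vol_pos[OF assms] by auto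
qed

text \<open>By the divergence theorem the gradient vanishes, and a constant with a vanishing facet mean is zero.\<close>

lemma P1_determined_by_facet_means:
  fixes \<phi> :: "'a::euclidean_space \<Rightarrow> real"
  assumes K: "cell K" and \<phi>: "\<phi> \<in> P1" and 0: "\<And>e. e \<in> facets K \<Longrightarrow> \<phi> (centroid e) = 0"
  shows "\<phi> x = 0"
proof -
  obtain A c where A: "linear A" "\<phi> = (\<lambda>x. A x + c)" using \<phi> by (auto simp: P1_def)
  have Ax: "A x = adjoint A 1 \<bullet> x" for x
    using adjoint_works[OF A(1), of x 1] by (simp add: inner_commute)
  have "vol K *\<^sub>R adjoint A 1 = (\<Sum>e\<in>facets K. (area e * (adjoint A 1 \<bullet> centroid e + c)) *\<^sub>R outer_normal K e)"
    by (rule divergence_identity[OF K, symmetric])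
  also have "\<dots> = 0"
    using 0 by (intro sum.neutral) (simp add: A(2) Ax)
  finally have "adjoint A 1 = 0" using cell_vol_pos[OF K] by simp
  then have "\<phi> x = c" for x by (simp add: A(2) Ax)
  moreover obtain e where "e \<in> facets K" using facets_nonempty[OF K] by auto
  ultimately show ?thesis using 0 by metis
qed

lemma P1_interpolation:
  fixes K :: "(real^'d) set"
  assumes K: "cell K"
  obtains \<phi> :: "real^'d \<Rightarrow> real^'d" where "\<phi> \<in> P1" "\<And>e. e \<in> facets K \<Longrightarrow> \<phi> (centroid e) = m e"
proof -
  have "\<exists>a c. \<forall>e\<in>facets K. a \<bullet> centroid e + c = m e $ i" for i
    using cell_interpolation[OF K, of "\<lambda>e. m e $ i"] by metis
  then obtain a c where ac: "\<And>i e. e \<in> facets K \<Longrightarrow> a i \<bullet> centroid e + c i = m e $ i" by metis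
  let ?A = "\<chi> i. a i" and ?c = "\<chi> i. c i"
  have "(\<lambda>x. ?A *v x + ?c) \<in> P1"
    using matrix_vector_mul_linear[of ?A] by (auto simp: P1_def)
  moreover have "?A *v centroid e + ?c = m e" if "e \<in> facets K" for e
    using ac[OF that] by (simp add: vec_eq_iff matrix_vector_mul_component)
  ultimately show ?thesis by (rule that)
qed

section \<open>The bilinear forms in terms of cell gradients and facet means\<close>

lemma V_space_P1: "v \<in> V_space T \<Longrightarrow> K \<in> T \<Longrightarrow> v K \<in> P1"
  by (auto simp: V_space_def)

lemma CR_space_V: "v \<in> CR_space \<Omega> T \<Longrightarrow> v \<in> V_space T"
  by (simp add: CR_space_def)

lemma Vhat_space_P0: "vhat \<in> Vhat_space \<Omega> T \<Longrightarrow> K \<in> T \<Longrightarrow> e \<in> facets K \<Longrightarrow> vhat e \<in> P0"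
  by (auto simp: Vhat_space_def mesh_facets_def)

lemma Q_space_P0: "q \<in> Q_space T \<Longrightarrow> K \<in> T \<Longrightarrow> q K \<in> P0"
  by (auto simp: Q_space_def)

lemma CR_space_iff:
  assumes T: "simplicial_mesh \<Omega> T"
  shows "v \<in> CR_space \<Omega> T \<longleftrightarrow> v \<in> V_space T \<and>
    (\<forall>K\<in>T. \<forall>K'\<in>T. \<forall>e\<in>facets K \<inter> facets K'. v K (centroid e) = v K' (centroid e)) \<and>
    (\<forall>K\<in>T. \<forall>e\<in>facets K. e \<subseteq> frontier \<Omega> \<longrightarrow> v K (centroid e) = 0)"
proof (cases "v \<in> V_space T")
  case True
  have pr: "proj0 (\<lambda>K e. v K) K e x = v K (centroid e)" if "K \<in> T" "e \<in> facets K" for K e x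
    using facet_proj_P1[OF mesh_cell[OF T that(1)] that(2) V_space_P1[OF True that(1)]]
    by (simp add: proj0_def)
  have ex: "\<exists>x. x \<in> e" if "K \<in> T" "e \<in> facets K" for K e
    using facet_compact_nonempty(2)[OF mesh_cell[OF T that(1)] that(2)] by blast
  have "(\<forall>K\<in>T. \<forall>K'\<in>T. \<forall>e\<in>facets K \<inter> facets K'. K \<noteq> K' \<longrightarrow>
          (\<forall>x\<in>e. proj0 (\<lambda>K e. v K) K e x - proj0 (\<lambda>K e. v K) K' e x = 0))
      \<longleftrightarrow> (\<forall>K\<in>T. \<forall>K'\<in>T. \<forall>e\<in>facets K \<inter> facets K'. v K (centroid e) = v K' (centroid e))"
  proof (intro ball_cong refl)
    fix K K' e assume K: "K \<in> T" "K' \<in> T" and e: "e \<in> facets K \<inter> facets K'"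
    then show "(K \<noteq> K' \<longrightarrow> (\<forall>x\<in>e. proj0 (\<lambda>K e. v K) K e x - proj0 (\<lambda>K e. v K) K' e x = 0))
        \<longleftrightarrow> v K (centroid e) = v K' (centroid e)"
      using ex[OF K(1), of e] pr[OF K(1), of e] pr[OF K(2), of e] by auto
  qed
  moreover have "(\<forall>K\<in>T. \<forall>e\<in>facets K. e \<subseteq> frontier \<Omega> \<longrightarrow> (\<forall>x\<in>e. proj0 (\<lambda>K e. v K) K e x = 0))
      \<longleftrightarrow> (\<forall>K\<in>T. \<forall>e\<in>facets K. e \<subseteq> frontier \<Omega> \<longrightarrow> v K (centroid e) = 0)"
  proof (intro ball_cong refl)
    fix K e assume K: "K \<in> T" and e: "e \<in> facets K"
    show "(e \<subseteq> frontier \<Omega> \<longrightarrow> (\<forall>x\<in>e. proj0 (\<lambda>K e. v K) K e x = 0))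
        \<longleftrightarrow> (e \<subseteq> frontier \<Omega> \<longrightarrow> v K (centroid e) = 0)"
      using ex[OF K e] pr[OF K e] by auto
  qed
  ultimately show ?thesis
    unfolding CR_space_def jump_free_def using True by simp
qed (simp add: CR_space_def)

lemma CR_space_continuous:
  assumes "simplicial_mesh \<Omega> T" "v \<in> CR_space \<Omega> T" "K \<in> T" "K' \<in> T" "e \<in> facets K" "e \<in> facets K'"
  shows "v K (centroid e) = v K' (centroid e)"
  using assms(2-) unfolding CR_space_iff[OF assms(1)] by blast

lemma CR_space_boundary:
  assumes "simplicial_mesh \<Omega> T" "v \<in> CR_space \<Omega> T" "K \<in> T" "e \<in> facets K" "e \<subseteq> frontier \<Omega>"
  shows "v K (centroid e) = 0"
  using assms(2-) unfolding CR_space_iff[OF assms(1)] by blast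

lemma vol_inner_grad:
  assumes T: "simplicial_mesh \<Omega> T" and "u \<in> V_space T" "v \<in> V_space T"
  shows "vol_inner T (grad u) (grad v) = (\<Sum>K\<in>T. vol K * (jac (u K) \<bullet> jac (v K)))"
  unfolding vol_inner_def grad_def
  by (intro sum.cong refl)
     (simp only: P1_jac(2)[OF V_space_P1[OF assms(2)]] P1_jac(2)[OF V_space_P1[OF assms(3)]]
        cell_integral_const[OF mesh_cell[OF T]])

lemma vol_inner_divg:
  assumes T: "simplicial_mesh \<Omega> T" and v: "v \<in> V_space T" and q: "q \<in> Q_space T"
  shows "vol_inner T (divg v) q = (\<Sum>K\<in>T. vol K * (trace (jac (v K)) * q K 0))"
  unfolding vol_inner_def divg_def
proof (intro sum.cong refl)
  fix K assume K: "K \<in> T"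
  have "trace (jacobian (v K) (at x)) \<bullet> q K x = trace (jac (v K)) * q K 0" for x
    using P1_jac(2)[OF V_space_P1[OF v K], of x] P0_eq[OF Q_space_P0[OF q K], of x] by simp
  then show "(LINT x|lebesgue_on K. trace (jacobian (v K) (at x)) \<bullet> q K x) = vol K * (trace (jac (v K)) * q K 0)"
    by (simp only: cell_integral_const[OF mesh_cell[OF T K]])
qed

lemma hat_diff_P1:
  assumes "v \<in> V_space T" "vhat \<in> Vhat_space \<Omega> T" "K \<in> T" "e \<in> facets K"
  shows "hat_diff vhat v K e \<in> P1"
proof -
  have "(\<lambda>x. vhat e x - v K x) \<in> P1"
    using Vhat_space_P0[OF assms(2-4)] P0_subset_P1 V_space_P1[OF assms(1,3)] by (intro P1_diff) auto
  then show ?thesis by (simp add: hat_diff_def[abs_def])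
qed

lemma bdry_inner_hat_diff:
  fixes T :: "(real^'d) set set"
  assumes T: "simplicial_mesh \<Omega> T" and v: "v \<in> V_space T" "vhat \<in> Vhat_space \<Omega> T"
    and z: "\<And>K e x. K \<in> T \<Longrightarrow> e \<in> facets K \<Longrightarrow> g K e x = z K e"
  shows "bdry_inner T g (hat_diff vhat v)
    = (\<Sum>K\<in>T. \<Sum>e\<in>facets K. area e * (z K e \<bullet> (vhat e 0 - v K (centroid e))))"
  unfolding bdry_inner_def
proof (intro sum.cong refl)
  fix K e assume K: "K \<in> T" and e: "e \<in> facets K"
  show "(LINT x|surface_measure e. g K e x \<bullet> hat_diff vhat v K e x)
      = area e * (z K e \<bullet> (vhat e 0 - v K (centroid e)))"
    using facet_integral_P1(2)[OF mesh_cell[OF T K] e hat_diff_P1[OF v K e], of "z K e"]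
      P0_eq[OF Vhat_space_P0[OF v(2) K e], of "centroid e"]
    by (simp add: z[OF K e] hat_diff_def)
qed

lemma normal_deriv_P1: "v \<in> V_space T \<Longrightarrow> K \<in> T \<Longrightarrow> normal_deriv v K e x = jac (v K) *v outer_normal K e"
  by (simp add: normal_deriv_def P1_jac(3)[OF V_space_P1])

lemma proj0_hat_diff:
  assumes T: "simplicial_mesh \<Omega> T" and v: "v \<in> V_space T" "vhat \<in> Vhat_space \<Omega> T"
    and K: "K \<in> T" "e \<in> facets K"
  shows "proj0 (hat_diff vhat v) K e x = vhat e 0 - v K (centroid e)"
  using facet_proj_P1[OF mesh_cell[OF T K(1)] K(2) hat_diff_P1[OF v K]]
    P0_eq[OF Vhat_space_P0[OF v(2) K], of "centroid e"]
  by (simp add: proj0_def hat_diff_def)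

text \<open>The identity behind the equivalence. If the hybrid part of the test pair carries the facet means of
\<open>v\<close>, the stabilization and the term with the normal derivative of \<open>u\<close> vanish. In the remaining boundary term \<open>uhat\<close> may be
replaced by \<open>w\<close>, which has the same facet means, and Green's formula turns it into the gradient of \<open>w - u\<close> tested
with the gradient of \<open>v\<close>: the volume term with \<open>u\<close> is exchanged for the one with \<open>w\<close>.\<close>

lemma a_form_conforming_test:
  assumes T: "simplicial_mesh \<Omega> T"
    and u: "u \<in> V_space T" "uhat \<in> Vhat_space \<Omega> T"
    and v: "v \<in> V_space T" "vhat \<in> Vhat_space \<Omega> T"
    and w: "w \<in> V_space T"
    and vm: "\<And>K e. K \<in> T \<Longrightarrow> e \<in> facets K \<Longrightarrow> v K (centroid e) = vhat e 0"
    and wm: "\<And>K e. K \<in> T \<Longrightarrow> e \<in> facets K \<Longrightarrow> w K (centroid e) = uhat e 0"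
  shows "a_form \<tau> T u uhat v vhat = vol_inner T (grad w) (grad v)"
proof -
  have 1: "bdry_inner T (normal_deriv u) (hat_diff vhat v) = 0"
    using bdry_inner_hat_diff[OF T v, of "normal_deriv u" "\<lambda>K e. jac (u K) *v outer_normal K e"]
    by (simp add: normal_deriv_P1[OF u(1)] vm)
  have 2: "bdry_inner T (\<lambda>K e x. (\<tau> * inverse (diameter e)) *\<^sub>R proj0 (hat_diff uhat u) K e x)
         (proj0 (hat_diff vhat v)) = 0"
    unfolding bdry_inner_def
    by (intro sum.neutral ballI) (simp add: proj0_hat_diff[OF T v] vm)
  have "bdry_inner T (normal_deriv v) (hat_diff uhat u)
      = (\<Sum>K\<in>T. \<Sum>e\<in>facets K. area e * ((jac (v K) *v outer_normal K e) \<bullet> (uhat e 0 - u K (centroid e))))"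
    by (rule bdry_inner_hat_diff[OF T u]) (rule normal_deriv_P1[OF v(1)])
  also have "\<dots> = (\<Sum>K\<in>T. vol K * (jac (v K) \<bullet> (jac (w K) - jac (u K))))"
  proof (intro sum.cong refl)
    fix K assume K: "K \<in> T"
    have "(\<Sum>e\<in>facets K. area e * ((jac (v K) *v outer_normal K e) \<bullet> (uhat e 0 - u K (centroid e))))
       = (\<Sum>e\<in>facets K. area e * ((jac (v K) *v outer_normal K e) \<bullet> (w K (centroid e) - u K (centroid e))))"
      by (intro sum.cong refl) (simp add: wm[OF K])
    also have "\<dots> = vol K * (jac (v K) \<bullet> (jac (w K) - jac (u K)))"
      using green_P1[OF mesh_cell[OF T K] P1_diff[OF V_space_P1[OF w K] V_space_P1[OF u(1) K]]]
      by (simp add: jac_diff[OF V_space_P1[OF w K] V_space_P1[OF u(1) K]])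
    finally show "(\<Sum>e\<in>facets K. area e * ((jac (v K) *v outer_normal K e) \<bullet> (uhat e 0 - u K (centroid e))))
       = vol K * (jac (v K) \<bullet> (jac (w K) - jac (u K)))" .
  qed
  finally have 3: "bdry_inner T (normal_deriv v) (hat_diff uhat u)
      = vol_inner T (grad w) (grad v) - vol_inner T (grad u) (grad v)"
    by (simp add: vol_inner_grad[OF T _ v(1)] u w inner_diff_right right_diff_distrib sum_subtractf inner_commute)
  show ?thesis unfolding a_form_def 1 2 3 by simp
qed

text \<open>The same exchange for the divergence: the form depends on the pair only through the facet
means of its hybrid part.\<close>

lemma b_form_facet_means:
  assumes T: "simplicial_mesh \<Omega> T"
    and v: "v \<in> V_space T" "vhat \<in> Vhat_space \<Omega> T" and q: "q \<in> Q_space T"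
    and w: "w \<in> V_space T"
    and wm: "\<And>K e. K \<in> T \<Longrightarrow> e \<in> facets K \<Longrightarrow> w K (centroid e) = vhat e 0"
  shows "b_form T v vhat q = - vol_inner T (divg w) q"
proof -
  have "bdry_inner T (hat_diff vhat v) (\<lambda>K e x. q K x *\<^sub>R outer_normal K e)
      = bdry_inner T (\<lambda>K e x. q K x *\<^sub>R outer_normal K e) (hat_diff vhat v)"
    by (simp add: bdry_inner_def inner_commute)
  also have "\<dots> = (\<Sum>K\<in>T. \<Sum>e\<in>facets K. area e * ((q K 0 *\<^sub>R outer_normal K e) \<bullet> (vhat e 0 - v K (centroid e))))"
    by (rule bdry_inner_hat_diff[OF T v]) (metis P0_eq Q_space_P0[OF q])
  also have "\<dots> = (\<Sum>K\<in>T. vol K * ((trace (jac (w K)) - trace (jac (v K))) * q K 0))"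
  proof (intro sum.cong refl)
    fix K assume K: "K \<in> T"
    have "(\<Sum>e\<in>facets K. area e * ((q K 0 *\<^sub>R outer_normal K e) \<bullet> (vhat e 0 - v K (centroid e))))
       = q K 0 * (\<Sum>e\<in>facets K. area e * (outer_normal K e \<bullet> (w K (centroid e) - v K (centroid e))))"
      unfolding sum_distrib_left by (intro sum.cong refl) (simp add: wm[OF K])
    also have "\<dots> = vol K * ((trace (jac (w K)) - trace (jac (v K))) * q K 0)"
      using divergence_P1[OF mesh_cell[OF T K] P1_diff[OF V_space_P1[OF w K] V_space_P1[OF v(1) K]]]
      by (simp add: jac_diff[OF V_space_P1[OF w K] V_space_P1[OF v(1) K]] trace_sub)
    finally show "(\<Sum>e\<in>facets K. area e * ((q K 0 *\<^sub>R outer_normal K e) \<bullet> (vhat e 0 - v K (centroid e))))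
       = vol K * ((trace (jac (w K)) - trace (jac (v K))) * q K 0)" .
  qed
  finally have "bdry_inner T (hat_diff vhat v) (\<lambda>K e x. q K x *\<^sub>R outer_normal K e)
      = vol_inner T (divg w) q - vol_inner T (divg v) q"
    by (simp add: vol_inner_divg[OF T _ q] v w algebra_simps sum_subtractf)
  then show ?thesis by (simp add: b_form_def)
qed

section \<open>Interpolation and traces of Crouzeix--Raviart functions\<close>

lemma facet_means_of_CR:
  assumes T: "simplicial_mesh \<Omega> T" and v: "v \<in> CR_space \<Omega> T"
  obtains vhat where "vhat \<in> Vhat_space \<Omega> T"
    "\<And>K e. K \<in> T \<Longrightarrow> e \<in> facets K \<Longrightarrow> v K (centroid e) = vhat e 0"
proof -
  \<comment> \<open>By weak continuity the choice of the cell does not matter.\<close>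
  define c where "c = (\<lambda>e. v (SOME K. K \<in> T \<and> e \<in> facets K) (centroid e))"
  have c: "v K (centroid e) = c e" if "K \<in> T" "e \<in> facets K" for K e
  proof -
    have "(SOME K. K \<in> T \<and> e \<in> facets K) \<in> T \<and> e \<in> facets (SOME K. K \<in> T \<and> e \<in> facets K)"
      by (rule someI[of _ K]) (use that in auto)
    then show ?thesis unfolding c_def using CR_space_continuous[OF T v that(1) _ that(2)] by blast
  qed
  let ?vhat = "\<lambda>e\<in>mesh_facets T. \<lambda>x. c e"
  have "?vhat \<in> Vhat_space \<Omega> T"
  proof -
    have "c e = 0" if "K \<in> T" "e \<in> facets K" "e \<subseteq> frontier \<Omega>" for K e
      using CR_space_boundary[OF T v that] c[OF that(1,2)] by simp
    then show ?thesis by (auto simp: Vhat_space_def P0_def mesh_facets_def)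
  qed
  moreover have "v K (centroid e) = ?vhat e 0" if "K \<in> T" "e \<in> facets K" for K e
    using that by (auto simp: c mesh_facets_def)
  ultimately show ?thesis by (rule that)
qed

lemma CR_interp_scalar_works:
  assumes T: "simplicial_mesh \<Omega> T" and P0: "\<And>e. e \<in> mesh_facets T \<Longrightarrow> vhat e \<in> P0"
    and K: "K \<in> T"
  shows "CR_interp_scalar T vhat K \<in> P1"
    and "e \<in> facets K \<Longrightarrow> CR_interp_scalar T vhat K (centroid e) = vhat e 0"
proof -
  let ?P = "\<lambda>w. w \<in> (\<Pi>\<^sub>E K\<in>T. P1) \<and> (\<forall>K\<in>T. \<forall>e\<in>facets K.
          (LINT x|surface_measure e. w K x) = (LINT x|surface_measure e. vhat e x))"
  have means: "(LINT x|surface_measure e. \<phi> x) = (LINT x|surface_measure e. vhat e x)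
      \<longleftrightarrow> \<phi> (centroid e) = vhat e 0" if "K \<in> T" "e \<in> facets K" "\<phi> \<in> P1" for K e \<phi>
  proof -
    have P: "vhat e \<in> P0" using P0 that by (auto simp: mesh_facets_def)
    note c = mesh_cell[OF T that(1)]
    show ?thesis
      using facet_integral_P1(1)[OF c that(2,3)] facet_integral_P1(1)[OF c that(2), of "vhat e"]
        P0_subset_P1 P P0_eq[OF P, of "centroid e"] facet_area_pos[OF c that(2)] by auto
  qed
  have "\<exists>\<phi>. \<phi> \<in> P1 \<and> (\<forall>e\<in>facets K. \<phi> (centroid e) = vhat e 0)" if K: "K \<in> T" for K
  proof -
    obtain a c where ac: "\<And>e. e \<in> facets K \<Longrightarrow> a \<bullet> centroid e + c = vhat e 0"
      using cell_interpolation[OF mesh_cell[OF T K], of "\<lambda>e. vhat e 0"] by blast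
    have "(\<lambda>x. a \<bullet> x + c) \<in> P1"
      by (auto simp: P1_def intro!: exI[of _ "\<lambda>x. a \<bullet> x"] bounded_linear.linear bounded_linear_inner_right)
    with ac show ?thesis by blast
  qed
  then obtain \<phi> where \<phi>: "\<And>K. K \<in> T \<Longrightarrow> \<phi> K \<in> P1 \<and> (\<forall>e\<in>facets K. \<phi> K (centroid e) = vhat e 0)"
    by metis
  have "\<exists>!w. ?P w"
  proof (rule ex1I[of _ "restrict \<phi> T"])
    show "?P (restrict \<phi> T)" using \<phi> by (auto simp: means)
  next
    fix w assume w: "?P w"
    show "w = restrict \<phi> T"
    proof (rule PiE_ext[of w T "\<lambda>_. P1"])
      fix K assume K: "K \<in> T"
      have wK: "w K \<in> P1" using w K by auto
      have wm: "w K (centroid e) = vhat e 0" if "e \<in> facets K" for e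
        using w K that means[OF K that wK] by blast
      have "w K x - \<phi> K x = 0" for x
        using P1_determined_by_facet_means[OF mesh_cell[OF T K] P1_diff[OF wK], of "\<phi> K"] \<phi>[OF K] wm
        by auto
      then show "w K = restrict \<phi> T K" using K by auto
    qed (use w \<phi> in auto)
  qed
  from theI'[OF this] have *: "?P (CR_interp_scalar T vhat)"
    unfolding CR_interp_scalar_def .
  then show P1: "CR_interp_scalar T vhat K \<in> P1" using K by auto
  show "CR_interp_scalar T vhat K (centroid e) = vhat e 0" if "e \<in> facets K"
    using * K that means[OF K that P1] by auto
qed

lemma P1_vec:
  assumes "\<And>i. (\<lambda>x. \<phi> i x) \<in> P1"
  shows "(\<lambda>x. (\<chi> i. \<phi> i x) :: real^'d) \<in> (P1 :: (real^'d \<Rightarrow> real^'d) set)"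
proof -
  have "\<exists>A c. linear A \<and> \<phi> i = (\<lambda>x. A x + c)" for i using assms by (auto simp: P1_def)
  then obtain A c where A: "\<And>i. linear (A i)" "\<And>i. \<phi> i = (\<lambda>x. A i x + c i)" by metis
  have "linear (\<lambda>x. \<chi> i. A i x)"
    by (intro linearI) (auto simp: vec_eq_iff linear_add[OF A(1)] linear_scale[OF A(1)])
  moreover have "(\<lambda>x. \<chi> i. \<phi> i x) = (\<lambda>x. (\<chi> i. A i x) + (\<chi> i. c i))"
    by (auto simp: vec_eq_iff A(2))
  ultimately show ?thesis by (auto simp: P1_def)
qed

lemma CR_interp_works:
  assumes T: "simplicial_mesh \<Omega> T" and v: "vhat \<in> Vhat_space \<Omega> T"
  shows "CR_interp T vhat \<in> V_space T"
    and "\<And>K e. K \<in> T \<Longrightarrow> e \<in> facets K \<Longrightarrow> CR_interp T vhat K (centroid e) = vhat e 0"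
    and "CR_interp T vhat \<in> CR_space \<Omega> T"
proof -
  have P0: "(\<lambda>y. vhat e y $ i) \<in> P0" if "e \<in> mesh_facets T" for e i
  proof -
    have "vhat e \<in> P0" using v that unfolding Vhat_space_def by (blast dest: PiE_mem)
    then obtain c where "vhat e = (\<lambda>x. c)" unfolding P0_def by blast
    then show ?thesis unfolding P0_def by auto
  qed
  note s = CR_interp_scalar_works[OF T, where vhat = "\<lambda>e y. vhat e y $ i" for i, OF P0]
  show V: "CR_interp T vhat \<in> V_space T"
    using s(1) by (auto simp: CR_interp_def V_space_def intro!: P1_vec)
  show m: "CR_interp T vhat K (centroid e) = vhat e 0" if "K \<in> T" "e \<in> facets K" for K e
    using s(2)[OF _ that] that by (simp add: CR_interp_def vec_eq_iff)
  have z: "vhat e 0 = 0" if Ke: "K \<in> T" "e \<in> facets K" "e \<subseteq> frontier \<Omega>" for K e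
  proof -
    obtain x where "x \<in> e" using facet_compact_nonempty(2)[OF mesh_cell[OF T Ke(1)] Ke(2)] by blast
    moreover have "e \<in> mesh_facets T" using Ke(1,2) by (auto simp: mesh_facets_def)
    ultimately have "vhat e x = 0" using v Ke(3) by (simp add: Vhat_space_def)
    then show ?thesis using P0_eq[OF Vhat_space_P0[OF v Ke(1,2)], of x] by simp
  qed
  show "CR_interp T vhat \<in> CR_space \<Omega> T"
    using V m z by (simp add: CR_space_iff[OF T])
qed

section \<open>Uniqueness of the Crouzeix--Raviart solution\<close>

text \<open>Such a function is constant on every cell; the value zero on a boundary cell spreads through common
facets to all cells.\<close>

lemma CR_gradient_zero:
  assumes \<Omega>: "convex_polyhedral_domain \<Omega>" and T: "simplicial_mesh \<Omega> T"
    and w: "w \<in> CR_space \<Omega> T" and 0: "\<And>K. K \<in> T \<Longrightarrow> jac (w K) = 0" and K: "K \<in> T"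
  shows "w K x = 0"
proof -
  have const: "w L x = w L 0" if "L \<in> T" for L x
    using P1_jac(1)[OF V_space_P1[OF CR_space_V[OF w] that], of x] 0[OF that] by simp
  define S where "S = {L \<in> T. w L 0 = 0}"
  obtain L e where L: "L \<in> T" "e \<in> facets L" "e \<subseteq> frontier \<Omega>"
    using boundary_facet_exists[OF \<Omega> T] by blast
  have "w L (centroid e) = 0" by (rule CR_space_boundary[OF T w L])
  then have "S \<noteq> {}" using const[OF L(1), of "centroid e"] L by (auto simp: S_def)
  moreover have "convex \<Omega>" using \<Omega> by (simp add: convex_polyhedral_domain_def)
  ultimately have "S = T"
  proof (intro mesh_facet_connected[OF _ T])
    fix L L' assume L: "L \<in> S" "L' \<in> T" "facets L \<inter> facets L' \<noteq> {}"
    then obtain e where e: "e \<in> facets L" "e \<in> facets L'" by auto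
    have L0: "L \<in> T" "w L 0 = 0" using L(1) by (auto simp: S_def)
    have "w L' 0 = 0"
      using CR_space_continuous[OF T w L0(1) L(2) e] const[OF L0(1), of "centroid e"] const[OF L(2), of "centroid e"] L0(2)
      by simp
    then show "L' \<in> S" using L(2) by (simp add: S_def)
  qed (auto simp: S_def)
  then show ?thesis using K const[OF K, of x] by (auto simp: S_def)
qed

text \<open>The Crouzeix--Raviart field with mean \<open>n\<close> on one interior facet and mean zero on all others has a
nonzero divergence only in the two adjacent cells, where its integrals are opposite. It tests the jump of a pressure across the
facet.\<close>

lemma CR_bubble:
  assumes \<Omega>: "open \<Omega>" "convex \<Omega>" and T: "simplicial_mesh \<Omega> T"
    and K: "K \<in> T" "K' \<in> T" "K \<noteq> K'" and e: "e \<in> facets K" "e \<in> facets K'"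
  obtains v where "v \<in> CR_space \<Omega> T"
    "\<And>r. (\<Sum>L\<in>T. vol L * (trace (jac (v L)) * r L)) = area e * (r K - r K')"
proof -
  let ?n = "outer_normal K e"
  have "\<exists>\<phi> :: real^'a \<Rightarrow> real^'a. \<phi> \<in> P1 \<and> (\<forall>e'\<in>facets L. \<phi> (centroid e') = (if e' = e then ?n else 0))"
    if "L \<in> T" for L
    using P1_interpolation[OF mesh_cell[OF T that], of "\<lambda>e'. if e' = e then ?n else 0"] by metis
  then obtain \<phi> where \<phi>: "\<And>L. L \<in> T \<Longrightarrow> \<phi> L \<in> P1"
    "\<And>L e'. L \<in> T \<Longrightarrow> e' \<in> facets L \<Longrightarrow> \<phi> L (centroid e') = (if e' = e then ?n else 0)"
    by metis
  let ?v = "restrict \<phi> T"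
  have "?v \<in> CR_space \<Omega> T"
    using \<phi> shared_facet_not_in_frontier[OF \<Omega> T K e] by (auto simp: CR_space_iff[OF T] V_space_def)
  moreover have "(\<Sum>L\<in>T. vol L * (trace (jac (?v L)) * r L)) = area e * (r K - r K')" for r
  proof -
    have div: "vol L * trace (jac (\<phi> L)) = (if e \<in> facets L then area e * (outer_normal L e \<bullet> ?n) else 0)"
      if L: "L \<in> T" for L
    proof -
      have "vol L * trace (jac (\<phi> L)) = (\<Sum>e'\<in>facets L. area e' * (outer_normal L e' \<bullet> \<phi> L (centroid e')))"
        by (rule divergence_P1[OF mesh_cell[OF T L] \<phi>(1)[OF L], symmetric])
      also have "\<dots> = (\<Sum>e'\<in>facets L. if e' = e then area e' * (outer_normal L e' \<bullet> ?n) else 0)"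
        by (intro sum.cong refl) (simp add: \<phi>(2)[OF L])
      finally show ?thesis using mesh_finite_cells[OF T L] by simp
    qed
    have "(\<Sum>L\<in>T. vol L * (trace (jac (?v L)) * r L))
        = (\<Sum>L\<in>T. if e \<in> facets L then area e * (outer_normal L e \<bullet> ?n) * r L else 0)"
      using div by (intro sum.cong refl) (simp flip: mult.assoc)
    also have "\<dots> = (\<Sum>L\<in>{L\<in>T. e \<in> facets L}. area e * (outer_normal L e \<bullet> ?n) * r L)"
      using mesh_finite[OF T] by (intro sum.inter_filter[symmetric])
    also have "\<dots> = area e * (?n \<bullet> ?n) * r K + area e * (- (?n \<bullet> ?n)) * r K'"
      using K(3) opposite_normals[OF T K e] by (simp add: at_most_two_cells[OF T K e])
    also have "?n \<bullet> ?n = 1"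
      using outer_normal_works(1)[OF mesh_cell[OF T K(1)] e(1)] by (simp add: dot_square_norm)
    finally show ?thesis by (simp add: algebra_simps)
  qed
  ultimately show ?thesis by (rule that)
qed

text \<open>A pressure that is orthogonal to all divergences has no jumps, hence is constant, and its mean
vanishes.\<close>

lemma pressure_zero:
  assumes \<Omega>: "convex_polyhedral_domain \<Omega>" and T: "simplicial_mesh \<Omega> T"
    and orth: "\<And>v. v \<in> CR_space \<Omega> T \<Longrightarrow> (\<Sum>L\<in>T. vol L * (trace (jac (v L)) * r L)) = 0"
    and mean: "(\<Sum>L\<in>T. vol L * r L) = 0" and K: "K \<in> T"
  shows "r K = 0"
proof -
  have op: "open \<Omega>" "convex \<Omega>" using \<Omega> by (auto simp: convex_polyhedral_domain_def)
  have "{L \<in> T. r L = r K} = T"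
  proof (rule mesh_facet_connected[OF op(2) T])
    fix L L' assume L: "L \<in> {L \<in> T. r L = r K}" "L' \<in> T" "facets L \<inter> facets L' \<noteq> {}"
    have "r L = r L'"
    proof (cases "L = L'")
      case False
      obtain e where e: "e \<in> facets L" "e \<in> facets L'" using L(3) by auto
      have LT: "L \<in> T" using L(1) by simp
      obtain v where v: "v \<in> CR_space \<Omega> T"
        "\<And>r. (\<Sum>L\<in>T. vol L * (trace (jac (v L)) * r L)) = area e * (r L - r L')"
        using CR_bubble[OF op T LT L(2) False e] by blast
      then have "area e * (r L - r L') = 0" using orth by metis
      then show ?thesis using facet_area_pos[OF mesh_cell[OF T L(2)] e(2)] by simp
    qed simp
    then show "L' \<in> {L \<in> T. r L = r K}" using L by auto
  qed (use K in auto)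
  then have "(\<Sum>L\<in>T. vol L * r L) = (\<Sum>L\<in>T. vol L) * r K"
    unfolding sum_distrib_right by (intro sum.cong) auto
  moreover have "(\<Sum>L\<in>T. vol L) > 0"
    using mesh_finite[OF T] K cell_vol_pos[OF mesh_cell[OF T]] by (intro sum_pos) auto
  ultimately show ?thesis using mean by simp
qed

text \<open>Testing the difference of the momentum equations with the difference \<open>w\<close> of the velocities, whose
discrete divergence vanishes, shows that \<open>w\<close> has zero gradient. What is left of the equations says that the difference
of the pressures is orthogonal to all divergences.\<close>

lemma CR_solution_unique:
  assumes \<Omega>: "convex_polyhedral_domain \<Omega>" and T: "simplicial_mesh \<Omega> T"
    and 1: "CR_solution \<Omega> T f u p" and 2: "CR_solution \<Omega> T f u' p'"
  shows "u = u'" "p = p'"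
proof -
  have u: "u \<in> CR_space \<Omega> T" "u' \<in> CR_space \<Omega> T" and p: "p \<in> Q_space T" "p' \<in> Q_space T"
    using 1 2 by (auto simp: CR_solution_def)
  note uV = CR_space_V[OF u(1)] CR_space_V[OF u(2)]
  define w where "w = (\<lambda>K\<in>T. \<lambda>x. u K x - u' K x)"
  have wV: "w \<in> V_space T"
    using V_space_P1[OF uV(1)] V_space_P1[OF uV(2)] by (auto simp: V_space_def w_def intro: P1_diff)
  have w: "w \<in> CR_space \<Omega> T"
    unfolding CR_space_iff[OF T]
  proof (intro conjI ballI impI wV)
    fix K K' e assume K: "K \<in> T" "K' \<in> T" and e: "e \<in> facets K \<inter> facets K'"
    then show "w K (centroid e) = w K' (centroid e)"
      using CR_space_continuous[OF T u(1) K, of e] CR_space_continuous[OF T u(2) K, of e] by (simp add: w_def)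
  next
    fix K e assume K: "K \<in> T" "e \<in> facets K" "e \<subseteq> frontier \<Omega>"
    show "w K (centroid e) = 0"
      using CR_space_boundary[OF T u(1) K] CR_space_boundary[OF T u(2) K] K(1) by (simp add: w_def)
  qed
  have jw: "jac (w K) = jac (u K) - jac (u' K)" if "K \<in> T" for K
    using that by (simp add: w_def jac_diff[OF V_space_P1[OF uV(1) that] V_space_P1[OF uV(2) that]])
  define r where "r = (\<lambda>K. p K 0 - p' K 0)"
  have momentum: "(\<Sum>K\<in>T. vol K * (jac (w K) \<bullet> jac (v K))) = (\<Sum>K\<in>T. vol K * (trace (jac (v K)) * r K))"
    if v: "v \<in> CR_space \<Omega> T" for v
  proof -
    have "vol_inner T (grad u) (grad v) - vol_inner T (divg v) p = vol_inner T (grad u') (grad v) - vol_inner T (divg v) p'"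
      using 1 2 v by (simp add: CR_solution_def)
    then have "(\<Sum>K\<in>T. vol K * (jac (u K) \<bullet> jac (v K))) - (\<Sum>K\<in>T. vol K * (jac (u' K) \<bullet> jac (v K)))
       = (\<Sum>K\<in>T. vol K * (trace (jac (v K)) * p K 0)) - (\<Sum>K\<in>T. vol K * (trace (jac (v K)) * p' K 0))"
      using uV CR_space_V[OF v] p by (simp add: vol_inner_grad[OF T] vol_inner_divg[OF T])
    then show ?thesis
      by (simp add: jw r_def inner_diff_left right_diff_distrib flip: sum_subtractf cong: sum.cong)
  qed
  have int0: "(\<Sum>K\<in>T. LINT x|lebesgue_on K. q K x) = (\<Sum>K\<in>T. vol K * q K 0)" if "q \<in> Q_space T" for q
  proof (intro sum.cong refl)
    fix K assume K: "K \<in> T"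
    have "q K = (\<lambda>x. q K 0)"
      using P0_eq[OF Q_space_P0[OF that K]] by (rule ext)
    then have "(LINT x|lebesgue_on K. q K x) = (LINT x|lebesgue_on K. q K 0)"
      by metis
    then show "(LINT x|lebesgue_on K. q K x) = vol K * q K 0"
      by (simp only: cell_integral_const[OF mesh_cell[OF T K]])
  qed
  have mean: "(\<Sum>K\<in>T. vol K * r K) = 0"
    using int0[OF p(1)] int0[OF p(2)] p by (simp add: Q_space_def r_def right_diff_distrib sum_subtractf)
  have div: "(\<Sum>K\<in>T. vol K * (trace (jac (w K)) * q K 0)) = 0" if q: "q \<in> Q_space T" for q
  proof -
    have "vol_inner T (divg u) q - vol_inner T (divg u') q = 0" using 1 2 q by (simp add: CR_solution_def)
    then show ?thesis
      using uV q by (simp add: vol_inner_divg[OF T] jw trace_sub algebra_simps sum_subtractf cong: sum.cong)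
  qed
  have "(\<Sum>K\<in>T. vol K * (jac (w K) \<bullet> jac (w K))) = 0"
    using momentum[OF w] div[OF p(1)] div[OF p(2)]
    by (simp add: r_def right_diff_distrib sum_subtractf)
  then have "vol K * (jac (w K) \<bullet> jac (w K)) = 0" if "K \<in> T" for K
    using that mesh_finite[OF T]
    by (subst (asm) sum_nonneg_eq_0_iff) (auto intro!: mult_nonneg_nonneg)
  then have jw0: "jac (w K) = 0" if "K \<in> T" for K
    using that cell_vol_pos[OF mesh_cell[OF T that]] by fastforce
  have "w K x = 0" if "K \<in> T" for K x
    by (rule CR_gradient_zero[OF \<Omega> T w jw0 that])
  then have eq: "u K = u' K" if "K \<in> T" for K
    using that by (auto simp: w_def fun_eq_iff)
  show "u = u'"
    using uV eq unfolding V_space_def by (rule PiE_ext)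
  have "r K = 0" if "K \<in> T" for K
  proof (rule pressure_zero[OF \<Omega> T _ mean that])
    fix v assume v: "v \<in> CR_space \<Omega> T"
    have "(\<Sum>K\<in>T. vol K * (jac (w K) \<bullet> jac (v K))) = 0"
      by (intro sum.neutral ballI) (simp add: jw0)
    then show "(\<Sum>K\<in>T. vol K * (trace (jac (v K)) * r K)) = 0" by (simp only: momentum[OF v])
  qed
  then have "p K x = p' K x" if "K \<in> T" for K x
    using that P0_eq[OF Q_space_P0[OF p(1) that], of x] P0_eq[OF Q_space_P0[OF p(2) that], of x]
    by (simp add: r_def)
  moreover have "p \<in> (\<Pi>\<^sub>E K\<in>T. P0)" "p' \<in> (\<Pi>\<^sub>E K\<in>T. P0)" using p by (auto simp: Q_space_def)
  ultimately show "p = p'" by (intro PiE_ext[of p T _ p']) (auto simp: fun_eq_iff)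
qed

section \<open>The HDG solution solves the Crouzeix--Raviart problem\<close>

lemma HDG_solves_CR:
  assumes T: "simplicial_mesh \<Omega> T" and hdg: "HDG_solution \<Omega> T \<tau> f u uhat p"
  shows "CR_solution \<Omega> T f (CR_interp T uhat) p"
proof -
  have u: "u \<in> V_space T" "uhat \<in> Vhat_space \<Omega> T" and p: "p \<in> Q_space T"
    and eq: "\<And>v vhat. v \<in> V_space T \<Longrightarrow> vhat \<in> Vhat_space \<Omega> T \<Longrightarrow>
       a_form \<tau> T u uhat v vhat + b_form T v vhat p = vol_inner T (\<lambda>K. f) v"
    and div: "\<And>q. q \<in> Q_space T \<Longrightarrow> b_form T u uhat q = 0"
    using hdg by (auto simp: HDG_solution_def)
  note w = CR_interp_works[OF T u(2)]
  have "vol_inner T (grad (CR_interp T uhat)) (grad v) - vol_inner T (divg v) p = vol_inner T (\<lambda>K. f) v"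
    if v: "v \<in> CR_space \<Omega> T" for v
  proof -
    note vV = CR_space_V[OF v]
    obtain vhat where vh: "vhat \<in> Vhat_space \<Omega> T"
      "\<And>K e. K \<in> T \<Longrightarrow> e \<in> facets K \<Longrightarrow> v K (centroid e) = vhat e 0"
      using facet_means_of_CR[OF T v] by blast
    show ?thesis
      using eq[OF vV vh(1)] a_form_conforming_test[OF T u vV vh(1) w(1) vh(2) w(2)]
        b_form_facet_means[OF T vV vh(1) p vV vh(2)] by simp
  qed
  moreover have "vol_inner T (divg (CR_interp T uhat)) q = 0" if q: "q \<in> Q_space T" for q
    using div[OF q] b_form_facet_means[OF T u q w(1,2)] by simp
  ultimately show ?thesis using w(3) p by (simp add: CR_solution_def)
qed

theorem theorem12:
  fixes \<Omega> :: "(real^'d) set"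
    and \<F> :: "(real^'d) set set set"
    and T :: "(real^'d) set set"
    and f :: "real^'d \<Rightarrow> real^'d"
    and \<tau> :: real
    and u uhat ustar :: "(real^'d, real^'d) pw"
    and p pstar :: "(real^'d, real) pw"
  assumes "CARD('d) \<in> {2, 3}"
    and "convex_polyhedral_domain \<Omega>"
    and "f square_integrable_on \<Omega>"
    and "shape_regular_family \<Omega> \<F>"
    and "T \<in> \<F>"
    and "\<tau> \<ge> 1"
    and "HDG_solution \<Omega> T \<tau> f u uhat p"
    and "CR_solution \<Omega> T f ustar pstar"
  shows "CR_interp T uhat = ustar \<and> p = pstar"
proof -
  have T: "simplicial_mesh \<Omega> T"
    using assms(4,5) by (simp add: shape_regular_family_def)
  show ?thesis
    using CR_solution_unique[OF assms(2) T HDG_solves_CR[OF T assms(7)] assms(8)] by blast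
qed

end
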